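(* Let $z(\alpha,t)$, $\alpha\in\mathbb{R}$, be a (sufficiently smooth and decaying) parametrization in the Lagrangian variable $\alpha$ of the free interface $\Sigma(t)$ of the two-dimensional water wave problem with surface tension, i.e. a solution of $z_{tt}+i=-\nabla P$, $\bar z_t=\mathfrak{H}\bar z_t$, with $P=-\frac{\partial_\alpha\theta}{|z_\alpha|}$ on $\Sigma(t)$. Let $\kappa$ be the change of coordinates from Lagrangian to arc-length $s$, and set $\delta:=\kappa_t\circ\kappa^{-1}$, $u:=\delta_s$. Then, in the Lagrangian coordinate, the tangent angle $\theta$ and $u\circ\kappa$ satisfy $$\begin{cases}\theta_t = i\mathfrak{H}(u\circ\kappa)+\phi,\\ (u\circ\kappa)_t=\Bigl(\dfrac{\partial_\alpha}{|z_\alpha|}\Bigr)^3\theta-a\,\dfrac{\partial_\alpha}{|z_\alpha|}\theta+\psi,\end{cases}$$ where $\phi,\psi$ are the error terms $$\phi=-i\operatorname{Re}\mathfrak{H}(u\circ\kappa)+\operatorname{Re}\mathfrak{H}(\theta_t)+\operatorname{Im}\Bigl(\bigl[\mathfrak{H},\tfrac{z_\alpha}{\bar z_\alpha}\bigr]\tfrac{\bar z_{t\alpha}}{z_\alpha}\Bigr),\qquad \psi=-\operatorname{Re}\Bigl(\frac{e^{-i\theta}z_{t\alpha}}{|z_\alpha|}\,(u\circ\kappa)\Bigr)+\theta_t^2 .$$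
   Context: Identify $\mathbb{R}^2$ with $\mathbb{C}$. The inviscid, incompressible, irrotational water of density $1$ and infinite depth occupies $\Omega(t)$, below the interface $\Sigma(t)$; air of zero density is above. Gravity is $-\mathbf{k}$ (i.e. $-i$), and surface tension is $1$. The fluid velocity $v$ and pressure $P$ satisfy $v_t+v\cdot\nabla v=-\mathbf{k}-\nabla P$, $\operatorname{div}v=\operatorname{curl}v=0$ in $\Omega(t)$. The interface is $z=z(\alpha,t)$, $\alpha\in\mathbb{R}$ Lagrangian, meaning $z_t(\alpha,t)=v(z(\alpha,t),t)$. The tangent angle $\theta$ is the angle $\Sigma(t)$ makes with the positive $x$-axis: $z_\alpha=|z_\alpha|e^{i\theta}$. The Hilbert transform on $\Sigma(t)$ is $$\mathfrak{H}f(\alpha,t)=\frac1{\pi i}\operatorname{p.v.}\int_{\mathbb{R}}\frac{f(\beta,t)z_\beta(\beta,t)}{z(\alpha,t)-z(\beta,t)}\,d\beta .$$ $[A,B]=AB-BA$ (a function stands for the corresponding multiplication operator). On real-valued $f$, $\operatorname{Re}\mathfrak{H}(f)$ is the real part of $\mathfrak{H}f$. The Taylor sign is $a:=-\frac{\partial P}{\partial n}$, with $n=ie^{i\theta}$ the unit normal pointing to the air, so that along $\Sigma(t)$ one has $-\nabla P=-\frac{\partial_\alpha P}{|z_\alpha|}e^{i\theta}+iae^{i\theta}$. Arc-length change of coordinates: $s=\kappa(\alpha,t)$, a diffeomorphism in $\alpha$ for each $t$, with $\kappa_\alpha=|z_\alpha|$; $\kappa^{-1}$ and compositions with $\kappa$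 are taken in the spatial variable at fixed $t$. Standing assumptions: the interface is non-self-intersecting, $\bigl|\frac{z(\alpha,t)-z(\beta,t)}{\alpha-\beta}\bigr|>c>0$ for all $\alpha\ne\beta$, and $a>0$. The solution is regular enough, with enough decay at infinity, that the derivatives and principal value integrals above exist and derivatives of decaying functions may be commuted with $\mathfrak{H}$ in the usual way. *)

theory Defs
  imports "HOL-Analysis.Analysis"
begin

text \<open>
  Functions on the interface have type \<open>real \<Rightarrow> real \<Rightarrow> 'a\<close>, with the spatial variable
  (\<open>\<alpha>\<close>, or arc length \<open>s\<close>) first and the time \<open>t\<close> second.
\<close>

definition D\<^sub>\<alpha> :: "(real \<Rightarrow> real \<Rightarrow> 'a::real_normed_vector) \<Rightarrow> real \<Rightarrow> real \<Rightarrow> 'a" where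
  "D\<^sub>\<alpha> f \<alpha> t = vector_derivative (\<lambda>x. f x t) (at \<alpha>)"

definition D\<^sub>t :: "('b \<Rightarrow> real \<Rightarrow> 'a::real_normed_vector) \<Rightarrow> 'b \<Rightarrow> real \<Rightarrow> 'a" where
  "D\<^sub>t f x t = vector_derivative (\<lambda>\<tau>. f x \<tau>) (at t)"

text \<open>All partial derivatives of order at most \<open>k\<close> exist and are jointly continuous for
  \<open>\<alpha> \<in> \<real>\<close>, \<open>t \<in> T\<close>.\<close>

primrec Ck_on :: "nat \<Rightarrow> real set \<Rightarrow> (real \<Rightarrow> real \<Rightarrow> 'a::real_normed_vector) \<Rightarrow> bool" where
  "Ck_on 0 T f \<longleftrightarrow> continuous_on (UNIV \<times> T) (\<lambda>(\<alpha>, t). f \<alpha> t)"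
| "Ck_on (Suc k) T f \<longleftrightarrow>
     continuous_on (UNIV \<times> T) (\<lambda>(\<alpha>, t). f \<alpha> t) \<and>
     (\<forall>\<alpha>. \<forall>t\<in>T. (\<lambda>x. f x t) differentiable (at \<alpha>) \<and> (\<lambda>\<tau>. f \<alpha> \<tau>) differentiable (at t)) \<and>
     Ck_on k T (D\<^sub>\<alpha> f) \<and> Ck_on k T (D\<^sub>t f)"

definition square_integrable :: "(real \<Rightarrow> complex) \<Rightarrow> bool" where
  "square_integrable f \<longleftrightarrow>
     f \<in> borel_measurable lborel \<and> integrable lborel (\<lambda>x. (cmod (f x))\<^sup>2)"


subsection \<open>The Hilbert transform on the interface\<close>

text \<open>The principal value is taken only at the singularity: on an interface with bounded
  \<open>z\<^sub>\<alpha>\<close> and the chord-arc bound, the truncated integrals of the Hilbert transform converge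
  absolutely for square integrable densities.\<close>

definition pv_integral :: "(real \<Rightarrow> complex) \<Rightarrow> real \<Rightarrow> complex" where
  "pv_integral g \<alpha> = Lim (at_right 0) (\<lambda>\<epsilon>. LBINT \<beta>:{\<beta>. \<epsilon> \<le> \<bar>\<beta> - \<alpha>\<bar>}. g \<beta>)"

definition hilbert ::
  "(real \<Rightarrow> real \<Rightarrow> complex) \<Rightarrow> (real \<Rightarrow> real \<Rightarrow> complex) \<Rightarrow> real \<Rightarrow> real \<Rightarrow> complex" where
  "hilbert z f \<alpha> t =
     1 / (of_real pi * \<i>) * pv_integral (\<lambda>\<beta>. f \<beta> t * D\<^sub>\<alpha> z \<beta> t / (z \<alpha> t - z \<beta> t)) \<alpha>"

definition cplx :: "(real \<Rightarrow> real \<Rightarrow> real) \<Rightarrow> real \<Rightarrow> real \<Rightarrow> complex" where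
  "cplx f \<alpha> t = complex_of_real (f \<alpha> t)"

definition mult_op ::
  "(real \<Rightarrow> real \<Rightarrow> complex) \<Rightarrow> (real \<Rightarrow> real \<Rightarrow> complex) \<Rightarrow> real \<Rightarrow> real \<Rightarrow> complex" where
  "mult_op g f \<alpha> t = g \<alpha> t * f \<alpha> t"

definition commutator ::
  "((real \<Rightarrow> real \<Rightarrow> complex) \<Rightarrow> real \<Rightarrow> real \<Rightarrow> complex) \<Rightarrow>
   ((real \<Rightarrow> real \<Rightarrow> complex) \<Rightarrow> real \<Rightarrow> real \<Rightarrow> complex) \<Rightarrow>
   (real \<Rightarrow> real \<Rightarrow> complex) \<Rightarrow> real \<Rightarrow> real \<Rightarrow> complex" where
  "commutator A B f \<alpha> t = A (B f) \<alpha> t - B (A f) \<alpha> t"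


subsection \<open>The fluid\<close>

definition interface :: "(real \<Rightarrow> real \<Rightarrow> complex) \<Rightarrow> real \<Rightarrow> complex set" where
  "interface z t = range (\<lambda>\<alpha>. z \<alpha> t)"

text \<open>The part of the plane below the interface: the points that can be joined, in the
  complement of the interface, to arbitrarily deep points.\<close>

definition fluid_domain :: "(real \<Rightarrow> real \<Rightarrow> complex) \<Rightarrow> real \<Rightarrow> complex set" where
  "fluid_domain z t =
     {w. \<exists>Y. \<forall>y<Y. connected_component (- interface z t) w (Complex 0 y)}"

definition closed_fluid_domain :: "(real \<Rightarrow> real \<Rightarrow> complex) \<Rightarrow> real \<Rightarrow> complex set" where
  "closed_fluid_domain z t = fluid_domain z t \<union> interface z t"

text \<open>At interface points the gradient of the pressure is one-sided: the derivative is taken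
  within the fluid together with its surface.\<close>

definition grad_within :: "(complex \<Rightarrow> real) \<Rightarrow> complex set \<Rightarrow> complex \<Rightarrow> complex" where
  "grad_within p S w =
     Complex (frechet_derivative p (at w within S) 1) (frechet_derivative p (at w within S) \<i>)"

definition grad_pressure ::
  "(real \<Rightarrow> real \<Rightarrow> complex) \<Rightarrow> (complex \<Rightarrow> real \<Rightarrow> real) \<Rightarrow> complex \<Rightarrow> real \<Rightarrow> complex" where
  "grad_pressure z P w t = grad_within (\<lambda>x. P x t) (closed_fluid_domain z t) w"

text \<open>With \<open>v = v\<^sub>1 + \<i> v\<^sub>2\<close> and \<open>A\<close> the spatial derivative of \<open>v\<close>, one has
  \<open>\<partial>\<^sub>x v = A 1\<close>, \<open>\<partial>\<^sub>y v = A \<i>\<close> and \<open>v \<cdot> \<nabla>v = A v\<close>.\<close>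

definition incompressible_euler_flow ::
  "real set \<Rightarrow> (real \<Rightarrow> real \<Rightarrow> complex) \<Rightarrow> (complex \<Rightarrow> real \<Rightarrow> complex) \<Rightarrow>
   (complex \<Rightarrow> real \<Rightarrow> real) \<Rightarrow> bool" where
  "incompressible_euler_flow T z v P \<longleftrightarrow>
     (\<forall>t\<in>T.
        continuous_on (closed_fluid_domain z t) (\<lambda>w. v w t) \<and>
        (\<lambda>w. P w t) differentiable_on closed_fluid_domain z t \<and>
        (\<forall>w\<in>fluid_domain z t.
           (\<lambda>x. v x t) differentiable (at w) \<and> (\<lambda>\<tau>. v w \<tau>) differentiable (at t) \<and>
           (let A = frechet_derivative (\<lambda>x. v x t) (at w) in
              D\<^sub>t v w t + A (v w t) = - \<i> - grad_pressure z P w t \<and>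
              Re (A 1) + Im (A \<i>) = 0 \<and>
              Im (A 1) - Re (A \<i>) = 0)))"

definition taylor_sign ::
  "(real \<Rightarrow> real \<Rightarrow> complex) \<Rightarrow> (real \<Rightarrow> real \<Rightarrow> real) \<Rightarrow> (complex \<Rightarrow> real \<Rightarrow> real) \<Rightarrow>
   real \<Rightarrow> real \<Rightarrow> real" where
  "taylor_sign z \<theta> P \<alpha> t = - (grad_pressure z P (z \<alpha> t) t \<bullet> (\<i> * exp (\<i> * of_real (\<theta> \<alpha> t))))"


subsection \<open>Arc length\<close>

definition D\<^sub>s_lagr ::
  "(real \<Rightarrow> real \<Rightarrow> complex) \<Rightarrow> (real \<Rightarrow> real \<Rightarrow> real) \<Rightarrow> real \<Rightarrow> real \<Rightarrow> real" where
  "D\<^sub>s_lagr z f \<alpha> t = D\<^sub>\<alpha> f \<alpha> t / cmod (D\<^sub>\<alpha> z \<alpha> t)"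

definition arclength_coordinate ::
  "real set \<Rightarrow> (real \<Rightarrow> real \<Rightarrow> complex) \<Rightarrow> (real \<Rightarrow> real \<Rightarrow> real) \<Rightarrow> bool" where
  "arclength_coordinate T z \<kappa> \<longleftrightarrow>
     (\<forall>t\<in>T. bij (\<lambda>\<alpha>. \<kappa> \<alpha> t) \<and> (\<forall>\<alpha>. D\<^sub>\<alpha> \<kappa> \<alpha> t = cmod (D\<^sub>\<alpha> z \<alpha> t)))"

definition delta :: "(real \<Rightarrow> real \<Rightarrow> real) \<Rightarrow> real \<Rightarrow> real \<Rightarrow> real" where
  "delta \<kappa> s t = D\<^sub>t \<kappa> (inv (\<lambda>\<alpha>. \<kappa> \<alpha> t) s) t"

definition u_arc :: "(real \<Rightarrow> real \<Rightarrow> real) \<Rightarrow> real \<Rightarrow> real \<Rightarrow> real" where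
  "u_arc \<kappa> = D\<^sub>\<alpha> (delta \<kappa>)"

text \<open>This is \<open>u \<circ> \<kappa>\<close>, with composition in the spatial variable at fixed time.\<close>

definition u_lagr :: "(real \<Rightarrow> real \<Rightarrow> real) \<Rightarrow> real \<Rightarrow> real \<Rightarrow> real" where
  "u_lagr \<kappa> \<alpha> t = u_arc \<kappa> (\<kappa> \<alpha> t) t"


subsection \<open>Error terms\<close>

definition err_phi ::
  "(real \<Rightarrow> real \<Rightarrow> complex) \<Rightarrow> (real \<Rightarrow> real \<Rightarrow> real) \<Rightarrow> (real \<Rightarrow> real \<Rightarrow> real) \<Rightarrow>
   real \<Rightarrow> real \<Rightarrow> complex" where
  "err_phi z \<theta> \<kappa> \<alpha> t =
     - \<i> * of_real (Re (hilbert z (cplx (u_lagr \<kappa>)) \<alpha> t))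
     + of_real (Re (hilbert z (cplx (D\<^sub>t \<theta>)) \<alpha> t))
     + of_real (Im (commutator (hilbert z) (mult_op (\<lambda>\<alpha> t. D\<^sub>\<alpha> z \<alpha> t / cnj (D\<^sub>\<alpha> z \<alpha> t)))
         (\<lambda>\<alpha> t. cnj (D\<^sub>\<alpha> (D\<^sub>t z) \<alpha> t) / D\<^sub>\<alpha> z \<alpha> t) \<alpha> t))"

definition err_psi ::
  "(real \<Rightarrow> real \<Rightarrow> complex) \<Rightarrow> (real \<Rightarrow> real \<Rightarrow> real) \<Rightarrow> (real \<Rightarrow> real \<Rightarrow> real) \<Rightarrow>
   real \<Rightarrow> real \<Rightarrow> real" where
  "err_psi z \<theta> \<kappa> \<alpha> t =
     - Re (exp (- \<i> * of_real (\<theta> \<alpha> t)) * D\<^sub>\<alpha> (D\<^sub>t z) \<alpha> t / of_real (cmod (D\<^sub>\<alpha> z \<alpha> t))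
           * of_real (u_lagr \<kappa> \<alpha> t))
     + (D\<^sub>t \<theta> \<alpha> t)\<^sup>2"

end

theory Submission
  imports Defs "HOL-Probability.Sinc_Integral" "HOL-Real_Asymp.Real_Asymp"
begin

text \<open>
  The tangent \<open>z\<^sub>\<alpha> = \<bar>z\<^sub>\<alpha>\<bar> e\<^sup>i\<^sup>\<theta>\<close> evolves by \<open>z\<^sub>t\<^sub>\<alpha> = z\<^sub>\<alpha> (U + i \<theta>\<^sub>t)\<close>, where \<open>U = u \<circ> \<kappa>\<close> is the rate of stretching of the interface
  (\<open>velocity_gradient\<close>). Thus the two unknowns of the system are one complex quantity, and both equations come from
  differentiating a complex identity and taking a real or an imaginary part.

  The first equation expresses holomorphy. The velocity satisfies \<open>cnj z\<^sub>t = H (cnj z\<^sub>t)\<close>, and the Hilbert transform obeys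
  \<open>\<partial>\<^sub>\<alpha> (H f) = z\<^sub>\<alpha> H (f\<^sub>\<alpha> / z\<^sub>\<alpha>)\<close> (\<open>Cauchy_pv_has_vector_derivative\<close>). Hence \<open>cnj z\<^sub>t\<^sub>\<alpha> / z\<^sub>\<alpha>\<close> is again a fixed point of \<open>H\<close>. Multiplying by
  \<open>z\<^sub>\<alpha> / cnj z\<^sub>\<alpha>\<close> turns it into \<open>U - i \<theta>\<^sub>t\<close> at the price of the commutator in \<open>err_phi\<close>; the imaginary part of the resulting identity
  is the equation (\<open>angle_equation\<close>).

  The second equation expresses momentum. The time derivative of \<open>z\<^sub>t\<^sub>\<alpha> / z\<^sub>\<alpha>\<close> has real part \<open>U\<^sub>t\<close> and leads to \<open>z\<^sub>t\<^sub>t\<^sub>\<alpha>\<close>, while the surface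
  tension law determines the tangential part of the pressure gradient and the Taylor sign is its normal part
  (\<open>velocity_equation\<close>).

  The analytic work lies in the differentiation of the principal value. For a density with square integrable derivative the
  truncated integral is differentiated and integrated by parts. The end points of the truncation leave two terms that
  converge to the same limit and cancel, and the truncation error is linear in the truncation length, uniformly on
  compact sets, because symmetrising the kernel about its singularity leaves a bounded function. So both the principal
  value and its derivative are uniform limits, and only local bounds on the curve beyond its tangent enter.
\<close>

section \<open>Finite differences and integrals over an annulus\<close>

lemma vector_derivative_imp_Lipschitz:
  fixes f :: "real \<Rightarrow> 'a::real_normed_vector"
  assumes "\<And>x. x \<in> {l..u} \<Longrightarrow> (f has_vector_derivative f' x) (at x)"
    and "\<And>x. x \<in> {l..u} \<Longrightarrow> norm (f' x) \<le> K"
    and "x \<in> {l..u}" "y \<in> {l..u}"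
  shows "norm (f x - f y) \<le> K * \<bar>x - y\<bar>"
proof -
  have "norm (f x - f y) \<le> K * norm (x - y)"
  proof (rule differentiable_bound[OF convex_real_interval(5)[of l u]])
    show "(f has_derivative (\<lambda>h. h *\<^sub>R f' x)) (at x within {l..u})" if "x \<in> {l..u}" for x
      using assms(1)[OF that] has_derivative_at_withinI unfolding has_vector_derivative_def by blast
    show "onorm (\<lambda>h. h *\<^sub>R f' x) \<le> K" if "x \<in> {l..u}" for x
      using assms(2)[OF that] by (intro onorm_le) (auto simp: mult.commute[of K] intro!: mult_left_mono)
  qed (use assms in auto)
  then show ?thesis by simp
qed

text \<open>The derivative in \<open>y\<close> of the second difference is \<open>f' (a + y) - f' (a - y)\<close>, which is itself of size \<open>y\<close>.
  This quadratic smallness is what makes symmetrised singular integrals converge.\<close>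

lemma second_difference_bound:
  fixes f :: "real \<Rightarrow> 'a::real_normed_vector"
  assumes f: "\<And>x. x \<in> {a-y..a+y} \<Longrightarrow> (f has_vector_derivative f' x) (at x)"
    and f': "\<And>x. x \<in> {a-y..a+y} \<Longrightarrow> (f' has_vector_derivative f'' x) (at x)"
    and K: "\<And>x. x \<in> {a-y..a+y} \<Longrightarrow> norm (f'' x) \<le> K"
    and y: "0 \<le> y"
  shows "norm (f (a + y) + f (a - y) - 2 *\<^sub>R f a) \<le> 2 * K * y\<^sup>2"
proof -
  have "norm ((f (a + y) + f (a - y)) - (f (a + 0) + f (a - 0))) \<le> (2 * K * y) * \<bar>y - 0\<bar>"
  proof (rule vector_derivative_imp_Lipschitz[of 0 y "\<lambda>s. f (a + s) + f (a - s)"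
        "\<lambda>s. f' (a + s) - f' (a - s)"])
    fix s assume s: "s \<in> {0..y}"
    have "((f \<circ> (\<lambda>s. a + s)) has_vector_derivative 1 *\<^sub>R f' (a + s)) (at s)"
      by (rule vector_diff_chain_at) (use s in \<open>auto intro!: f derivative_eq_intros\<close>)
    moreover have "((f \<circ> (\<lambda>s. a - s)) has_vector_derivative (-1) *\<^sub>R f' (a - s)) (at s)"
      by (rule vector_diff_chain_at) (use s in \<open>auto intro!: f derivative_eq_intros\<close>)
    ultimately show "((\<lambda>s. f (a + s) + f (a - s)) has_vector_derivative f' (a + s) - f' (a - s)) (at s)"
      using has_vector_derivative_add by (fastforce simp: o_def)
    have "norm (f' (a + s) - f' (a - s)) \<le> K * \<bar>(a + s) - (a - s)\<bar>"
      using s by (intro vector_derivative_imp_Lipschitz[of "a-y" "a+y" f' f'']) (auto intro: f' K)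
    also have "\<dots> \<le> 2 * K * y"
      using s order_trans[OF norm_ge_zero K[of a]] by (auto intro!: mult_left_mono)
    finally show "norm (f' (a + s) - f' (a - s)) \<le> 2 * K * y" .
  qed (use y in auto)
  then show ?thesis
    using y by (simp add: power2_eq_square scaleR_2 algebra_simps)
qed

lemma continuous_bounded_on_interval:
  fixes f :: "real \<Rightarrow> 'a::real_normed_vector"
  assumes "continuous_on UNIV f"
  obtains K where "0 < K" "\<And>x. x \<in> {l..u} \<Longrightarrow> norm (f x) \<le> K"
proof -
  have "bounded (f ` {l..u})"
    using assms by (intro compact_imp_bounded compact_continuous_image) (auto intro: continuous_on_subset)
  then show ?thesis
    using that unfolding bounded_pos by auto
qed

text \<open>Folding the two sides of \<open>a\<close> onto one another cancels the odd part of the singularity in a principal value.\<close>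

lemma lebesgue_integral_annulus:
  fixes h :: "real \<Rightarrow> 'a::{banach, second_countable_topology}"
  assumes "set_integrable lborel {x. p \<le> \<bar>x - a\<bar> \<and> \<bar>x - a\<bar> < q} h" and "0 < p"
  shows "(LBINT x:{x. p \<le> \<bar>x - a\<bar> \<and> \<bar>x - a\<bar> < q}. h x) = (LBINT y:{p..<q}. h (a + y) + h (a - y))"
    and "set_integrable lborel {p..<q} (\<lambda>y. h (a + y) + h (a - y))"
proof -
  have eq: "{x. p \<le> \<bar>x - a\<bar> \<and> \<bar>x - a\<bar> < q} = {a+p..<a+q} \<union> {a-q<..a-p}"
    using assms(2) by auto
  have int: "set_integrable lborel {a+p..<a+q} h" "set_integrable lborel {a-q<..a-p} h"
    using assms(1) unfolding eq by (auto intro: set_integrable_subset)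
  have ind: "indicator {a+p..<a+q} (a + 1 * y) = (indicator {p..<q} y :: real)"
    "indicator {a-q<..a-p} (a + (-1) * y) = (indicator {p..<q} y :: real)" for y
    by (auto simp: indicator_def)
  have "integrable lborel (\<lambda>y. indicator {p..<q} y *\<^sub>R h (a + y))"
    using lborel_integrable_real_affine[OF int(1)[unfolded set_integrable_def], of 1 a]
    unfolding ind by simp
  moreover have "integrable lborel (\<lambda>y. indicator {p..<q} y *\<^sub>R h (a - y))"
    using lborel_integrable_real_affine[OF int(2)[unfolded set_integrable_def], of "-1" a]
    unfolding ind by simp
  ultimately have int': "set_integrable lborel {p..<q} (\<lambda>y. h (a + y))"
      "set_integrable lborel {p..<q} (\<lambda>y. h (a - y))"
    by (auto simp: set_integrable_def)
  then show "set_integrable lborel {p..<q} (\<lambda>y. h (a + y) + h (a - y))"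
    by (rule set_integral_add)
  have "(LBINT x:{a+p..<a+q}. h x) = (LBINT y:{p..<q}. h (a + y))"
    unfolding set_lebesgue_integral_def
    by (subst lborel_integral_real_affine[of 1 _ a]) (simp_all only: ind, simp_all)
  moreover have "(LBINT x:{a-q<..a-p}. h x) = (LBINT y:{p..<q}. h (a - y))"
    unfolding set_lebesgue_integral_def
    by (subst lborel_integral_real_affine[of "-1" _ a]) (simp_all only: ind, simp_all)
  ultimately show "(LBINT x:{x. p \<le> \<bar>x - a\<bar> \<and> \<bar>x - a\<bar> < q}. h x) = (LBINT y:{p..<q}. h (a + y) + h (a - y))"
    unfolding eq using assms(2) int int' by (subst set_integral_Un) (auto simp: set_integral_add)
qed

lemma norm_set_integral_interval_le:
  fixes s :: "real \<Rightarrow> 'a::{banach, second_countable_topology}"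
  assumes "set_integrable lborel {p..<q} s" and "\<And>y. y \<in> {p..<q} \<Longrightarrow> norm (s y) \<le> C" and "p \<le> q"
  shows "norm (LBINT y:{p..<q}. s y) \<le> C * (q - p)"
proof -
  have "norm (LBINT y:{p..<q}. s y) \<le> (LBINT y:{p..<q}. norm (s y))"
    unfolding set_lebesgue_integral_def
    by (rule order_trans[OF integral_norm_bound]) (simp add: abs_mult)
  also have "\<dots> \<le> (LBINT y:{p..<q}. C)"
  proof (intro set_integral_mono set_integrable_norm assms(1))
    show "set_integrable lborel {p..<q} (\<lambda>_. C)"
      by (rule set_integrable_subset[of lborel "{p..q}"]) (auto intro!: borel_integrable_atLeastAtMost')
  qed (use assms(2) in auto)
  also have "\<dots> = C * (q - p)"
    using assms(3) by (simp add: set_integral_const)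
  finally show ?thesis .
qed

section \<open>Integrability of the Cauchy kernel off the diagonal\<close>

lemma set_integrable_inverse_square_tail:
  fixes a \<epsilon> :: real
  assumes "0 < \<epsilon>"
  shows "set_integrable lborel {x. \<epsilon> \<le> \<bar>x - a\<bar>} (\<lambda>x. 1 / (x - a)\<^sup>2)"
proof -
  have "integrable lborel (\<lambda>x::real. inverse (1 + x\<^sup>2))"
    using integrable_inverse_1_plus_square by (simp add: set_integrable_def)
  then have "integrable lborel (\<lambda>x. inverse (1 + (x - a)\<^sup>2))"
    using lborel_integrable_real_affine[of "\<lambda>x. inverse (1 + x\<^sup>2)" 1 "-a"] by simp
  then have "integrable lborel (\<lambda>x. (1 + 1 / \<epsilon>\<^sup>2) * inverse (1 + (x - a)\<^sup>2))"
    by simp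
  then show ?thesis
    unfolding set_integrable_def
  proof (rule Bochner_Integration.integrable_bound)
    show "AE x in lborel. norm (indicat_real {x. \<epsilon> \<le> \<bar>x - a\<bar>} x *\<^sub>R (1 / (x - a)\<^sup>2))
      \<le> norm ((1 + 1 / \<epsilon>\<^sup>2) * inverse (1 + (x - a)\<^sup>2))"
    proof (intro AE_I2)
      fix x
      have "1 / (x - a)\<^sup>2 \<le> (1 + 1 / \<epsilon>\<^sup>2) * inverse (1 + (x - a)\<^sup>2)" if "\<epsilon> \<le> \<bar>x - a\<bar>"
      proof -
        define A where "A = (x - a)\<^sup>2"
        define E where "E = \<epsilon>\<^sup>2"
        have "E \<le> A" "0 < E"
          using that assms by (auto simp: abs_le_square_iff[symmetric] A_def E_def)
        then have "1 / A \<le> (1 + 1 / E) * inverse (1 + A)"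
          by (simp add: field_simps add_pos_pos)
        then show ?thesis
          by (simp add: A_def E_def)
      qed
      then show "norm (indicat_real {x. \<epsilon> \<le> \<bar>x - a\<bar>} x *\<^sub>R (1 / (x - a)\<^sup>2))
        \<le> norm ((1 + 1 / \<epsilon>\<^sup>2) * inverse (1 + (x - a)\<^sup>2))"
        by (auto simp: indicator_def)
    qed
  qed simp
qed

text \<open>Cauchy--Schwarz in pointwise form: away from \<open>a\<close> the square of \<open>1 / \<bar>x - a\<bar>\<close> is integrable, so a kernel with that
  decay pairs absolutely with any square integrable density.\<close>

lemma set_integrable_square_integrable_mult:
  fixes g w :: "real \<Rightarrow> complex"
  assumes g: "square_integrable g" and w: "w \<in> borel_measurable lborel" and "0 < \<epsilon>"
    and bound: "\<And>x. \<epsilon> \<le> \<bar>x - a\<bar> \<Longrightarrow> cmod (w x) \<le> B / \<bar>x - a\<bar>"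
  shows "set_integrable lborel {x. \<epsilon> \<le> \<bar>x - a\<bar>} (\<lambda>x. g x * w x)"
proof -
  let ?S = "{x. \<epsilon> \<le> \<bar>x - a\<bar>}"
  have "integrable lborel (\<lambda>x. (cmod (g x))\<^sup>2)"
    using g by (simp add: square_integrable_def)
  moreover have "integrable lborel (\<lambda>x. B\<^sup>2 * (indicator ?S x *\<^sub>R (1 / (x - a)\<^sup>2)))"
    using set_integrable_inverse_square_tail[OF \<open>0 < \<epsilon>\<close>, of a]
    unfolding set_integrable_def by (rule integrable_mult_right)
  ultimately have "integrable lborel (\<lambda>x. (cmod (g x))\<^sup>2 + B\<^sup>2 * (indicator ?S x *\<^sub>R (1 / (x - a)\<^sup>2)))"
    by (rule Bochner_Integration.integrable_add)
  then show ?thesis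
    unfolding set_integrable_def
  proof (rule Bochner_Integration.integrable_bound)
    show "(\<lambda>x. indicat_real ?S x *\<^sub>R (g x * w x)) \<in> borel_measurable lborel"
      using g[unfolded square_integrable_def, THEN conjunct1] w by measurable
    show "AE x in lborel. norm (indicat_real ?S x *\<^sub>R (g x * w x))
      \<le> norm ((cmod (g x))\<^sup>2 + B\<^sup>2 * (indicator ?S x *\<^sub>R (1 / (x - a)\<^sup>2)))"
    proof (intro AE_I2)
      fix x
      have "cmod (g x) * cmod (w x) \<le> (cmod (g x))\<^sup>2 + B\<^sup>2 * (1 / (x - a)\<^sup>2)" if "\<epsilon> \<le> \<bar>x - a\<bar>"
      proof -
        have "2 * (cmod (g x) * cmod (w x)) \<le> (cmod (g x))\<^sup>2 + (cmod (w x))\<^sup>2"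
          using sum_squares_bound[of "cmod (g x)" "cmod (w x)"] by simp
        moreover have "0 \<le> cmod (g x) * cmod (w x)"
          by simp
        moreover have "(cmod (w x))\<^sup>2 \<le> (B / \<bar>x - a\<bar>)\<^sup>2"
          using bound[OF that] by (intro power_mono) auto
        then have "(cmod (w x))\<^sup>2 \<le> B\<^sup>2 * (1 / (x - a)\<^sup>2)"
          by (simp add: power_divide)
        ultimately show ?thesis
          by linarith
      qed
      then show "norm (indicat_real ?S x *\<^sub>R (g x * w x))
        \<le> norm ((cmod (g x))\<^sup>2 + B\<^sup>2 * (indicator ?S x *\<^sub>R (1 / (x - a)\<^sup>2)))"
        by (auto simp: indicator_def norm_mult)
    qed
  qed
qed

section \<open>Principal values along a chord-arc curve\<close>

text \<open>The interface at a fixed time. The chord-arc bound makes the Cauchy kernel comparable to that of the line,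
  the second derivative makes the symmetrised kernel bounded, and the third makes the boundary terms cancel at a rate.\<close>

locale chord_arc_curve =
  fixes z z' z'' z''' :: "real \<Rightarrow> complex" and c M :: real
  assumes c_pos: "0 < c"
    and chord_arc: "\<And>\<alpha> \<beta>. c * \<bar>\<alpha> - \<beta>\<bar> \<le> cmod (z \<alpha> - z \<beta>)"
    and z': "\<And>\<alpha>. (z has_vector_derivative z' \<alpha>) (at \<alpha>)"
    and z'': "\<And>\<alpha>. (z' has_vector_derivative z'' \<alpha>) (at \<alpha>)"
    and z''': "\<And>\<alpha>. (z'' has_vector_derivative z''' \<alpha>) (at \<alpha>)"
    and continuous_z''': "continuous_on UNIV z'''"
    and z'_bounded: "\<And>\<alpha>. cmod (z' \<alpha>) \<le> M"
begin

lemma z_continuous: "continuous_on UNIV z" "continuous_on UNIV z'" "continuous_on UNIV z''"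
  using z' z'' z''' by (auto intro!: continuous_at_imp_continuous_on has_vector_derivative_continuous)

lemma z_measurable [measurable]: "z \<in> borel_measurable borel" "z' \<in> borel_measurable borel"
  using z_continuous by (auto intro: borel_measurable_continuous_onI)

lemma z_neq: "\<alpha> \<noteq> \<beta> \<Longrightarrow> z \<alpha> - z \<beta> \<noteq> 0"
  using chord_arc[of \<alpha> \<beta>] mult_pos_pos[OF c_pos, of "\<bar>\<alpha> - \<beta>\<bar>"] by auto

lemma Cauchy_kernel_bound: "cmod (1 / (z \<alpha> - z \<beta>)) \<le> 1 / c / \<bar>\<beta> - \<alpha>\<bar>"
proof (cases "\<alpha> = \<beta>")
  case False
  then show ?thesis
    using chord_arc[of \<alpha> \<beta>] c_pos mult_pos_pos[OF c_pos, of "\<bar>\<alpha> - \<beta>\<bar>"]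
    by (auto simp: norm_divide divide_simps abs_minus_commute mult.commute)
qed simp

lemma set_integrable_Cauchy_kernel:
  assumes "square_integrable g" "0 < \<epsilon>"
  shows "set_integrable lborel {\<beta>. \<epsilon> \<le> \<bar>\<beta> - \<alpha>\<bar>} (\<lambda>\<beta>. g \<beta> / (z \<alpha> - z \<beta>))"
  using set_integrable_square_integrable_mult[OF assms(1) _ assms(2), of "\<lambda>\<beta>. 1 / (z \<alpha> - z \<beta>)" \<alpha> "1/c"]
    Cauchy_kernel_bound by simp

text \<open>This is the truncation whose limit \<open>pv_integral\<close> takes, kept without the factor \<open>z'\<close> in the density so that it
  applies both to \<open>f z'\<close> and to \<open>f'\<close>.\<close>

definition truncated_Cauchy :: "(real \<Rightarrow> complex) \<Rightarrow> real \<Rightarrow> real \<Rightarrow> complex" where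
  "truncated_Cauchy g \<epsilon> \<alpha> = (LBINT \<beta>:{\<beta>. \<epsilon> \<le> \<bar>\<beta> - \<alpha>\<bar>}. g \<beta> / (z \<alpha> - z \<beta>))"

lemma truncated_diff:
  assumes "square_integrable g" "0 < p" "p \<le> q"
  shows "truncated_Cauchy g p \<alpha> - truncated_Cauchy g q \<alpha> =
      (LBINT y:{p..<q}. g (\<alpha> + y) / (z \<alpha> - z (\<alpha> + y)) + g (\<alpha> - y) / (z \<alpha> - z (\<alpha> - y)))"
    and "set_integrable lborel {p..<q} 
      (\<lambda>y. g (\<alpha> + y) / (z \<alpha> - z (\<alpha> + y)) + g (\<alpha> - y) / (z \<alpha> - z (\<alpha> - y)))"
proof -
  let ?A = "{\<beta>. p \<le> \<bar>\<beta> - \<alpha>\<bar> \<and> \<bar>\<beta> - \<alpha>\<bar> < q}" and ?h = "\<lambda>\<beta>. g \<beta> / (z \<alpha> - z \<beta>)"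
  have eq: "{\<beta>. p \<le> \<bar>\<beta> - \<alpha>\<bar>} = {\<beta>. q \<le> \<bar>\<beta> - \<alpha>\<bar>} \<union> ?A"
    using assms by auto
  have int: "set_integrable lborel {\<beta>. q \<le> \<bar>\<beta> - \<alpha>\<bar>} ?h" "set_integrable lborel {\<beta>. p \<le> \<bar>\<beta> - \<alpha>\<bar>} ?h"
    using assms by (auto intro: set_integrable_Cauchy_kernel)
  then have A: "set_integrable lborel ?A ?h"
    by (rule_tac set_integrable_subset[OF int(2)]) auto
  have "truncated_Cauchy g p \<alpha> - truncated_Cauchy g q \<alpha> = (LBINT \<beta>:?A. ?h \<beta>)"
    unfolding truncated_Cauchy_def eq using int A assms by (subst set_integral_Un) auto
  then show "truncated_Cauchy g p \<alpha> - truncated_Cauchy g q \<alpha> =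
      (LBINT y:{p..<q}. g (\<alpha> + y) / (z \<alpha> - z (\<alpha> + y)) + g (\<alpha> - y) / (z \<alpha> - z (\<alpha> - y)))"
    using lebesgue_integral_annulus(1)[OF A \<open>0 < p\<close>] by simp
  show "set_integrable lborel {p..<q} 
      (\<lambda>y. g (\<alpha> + y) / (z \<alpha> - z (\<alpha> + y)) + g (\<alpha> - y) / (z \<alpha> - z (\<alpha> - y)))"
    using lebesgue_integral_annulus(2)[OF A \<open>0 < p\<close>] by simp
qed

text \<open>After symmetrisation the numerator is a difference of densities times a chord, plus a density times a second
  difference of \<open>z\<close>; both are \<open>O(y\<^sup>2)\<close>, exactly as large as the product of the two chords in the denominator.\<close>

lemma symmetrized_kernel_bounded:
  assumes g': "\<And>\<alpha>. (g has_vector_derivative g' \<alpha>) (at \<alpha>)" and "continuous_on UNIV g'"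
  obtains C where "0 < C" "\<And>\<alpha> y. \<alpha> \<in> {l..u} \<Longrightarrow> y \<in> {0<..1} \<Longrightarrow>
     cmod (g (\<alpha> + y) / (z \<alpha> - z (\<alpha> + y)) + g (\<alpha> - y) / (z \<alpha> - z (\<alpha> - y))) \<le> C"
proof -
  have cg: "continuous_on UNIV g"
    using g' by (auto intro!: continuous_at_imp_continuous_on has_vector_derivative_continuous)
  obtain K0 where K0: "0 < K0" "\<And>x. x \<in> {l-1..u+1} \<Longrightarrow> norm (g x) \<le> K0"
    using continuous_bounded_on_interval[OF cg] by blast
  obtain K1 where K1: "0 < K1" "\<And>x. x \<in> {l-1..u+1} \<Longrightarrow> norm (g' x) \<le> K1"
    using continuous_bounded_on_interval[OF assms(2)] by blast
  obtain Z2 where Z2: "0 < Z2" "\<And>x. x \<in> {l-1..u+1} \<Longrightarrow> norm (z'' x) \<le> Z2"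
    using continuous_bounded_on_interval[OF z_continuous(3)] by blast
  have M: "0 \<le> M"
    using z'_bounded[of 0] norm_ge_zero order_trans by blast
  show ?thesis
  proof
    show "0 < (2 * K1 * M + 2 * K0 * Z2) / c\<^sup>2"
      using c_pos M K0 K1 Z2 by (intro divide_pos_pos add_nonneg_pos) auto
    fix \<alpha> y assume \<alpha>: "\<alpha> \<in> {l..u}" and y: "y \<in> {0<..(1::real)}"
    let ?p = "z \<alpha> - z (\<alpha> + y)" and ?m = "z \<alpha> - z (\<alpha> - y)"
    have nz: "?p \<noteq> 0" "?m \<noteq> 0"
      using y by (auto intro!: z_neq simp del: right_minus_eq)
    have "g (\<alpha> + y) / ?p + g (\<alpha> - y) / ?m =
        ((g (\<alpha> + y) - g (\<alpha> - y)) * ?m + g (\<alpha> - y) * (?m + ?p)) / (?p * ?m)"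
      using nz by (simp add: field_simps)
    also have "cmod \<dots> \<le> ((2 * K1 * M + 2 * K0 * Z2) * y\<^sup>2) / (c\<^sup>2 * y\<^sup>2)"
      unfolding norm_divide norm_mult
    proof (rule frac_le)
      have "cmod (g (\<alpha> + y) - g (\<alpha> - y)) \<le> K1 * \<bar>(\<alpha> + y) - (\<alpha> - y)\<bar>"
        using \<alpha> y by (intro vector_derivative_imp_Lipschitz[of "l-1" "u+1" g g']) (auto intro: g' K1)
      then have 1: "cmod (g (\<alpha> + y) - g (\<alpha> - y)) \<le> 2 * K1 * y"
        using y by simp
      have "cmod ?m \<le> M * \<bar>\<alpha> - (\<alpha> - y)\<bar>"
        using \<alpha> y by (intro vector_derivative_imp_Lipschitz[of "l-1" "u+1" z z']) (auto intro: z' z'_bounded)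
      then have 2: "cmod ?m \<le> M * y"
        using y by simp
      have "cmod (z (\<alpha> + y) + z (\<alpha> - y) - 2 *\<^sub>R z \<alpha>) \<le> 2 * Z2 * y\<^sup>2"
        using \<alpha> y by (intro second_difference_bound[of \<alpha> y z z' z'']) (auto intro!: z' z'' Z2)
      then have 3: "cmod (?m + ?p) \<le> 2 * Z2 * y\<^sup>2"
        by (subst norm_minus_cancel[symmetric]) (simp add: scaleR_2 algebra_simps)
      have 4: "cmod (g (\<alpha> - y)) \<le> K0"
        using \<alpha> y by (intro K0) auto
      have "cmod ((g (\<alpha> + y) - g (\<alpha> - y)) * ?m + g (\<alpha> - y) * (?m + ?p))
          \<le> cmod (g (\<alpha> + y) - g (\<alpha> - y)) * cmod ?m + cmod (g (\<alpha> - y)) * cmod (?m + ?p)"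
        by (metis norm_mult norm_triangle_ineq)
      also have "\<dots> \<le> (2 * K1 * y) * (M * y) + K0 * (2 * Z2 * y\<^sup>2)"
        using 1 2 3 4 y K0 K1 by (intro add_mono mult_mono) auto
      finally show "cmod ((g (\<alpha> + y) - g (\<alpha> - y)) * ?m + g (\<alpha> - y) * (?m + ?p))
          \<le> (2 * K1 * M + 2 * K0 * Z2) * y\<^sup>2"
        by (simp add: algebra_simps power2_eq_square)
      have "(c * y) * (c * y) \<le> cmod ?p * cmod ?m"
        using chord_arc[of \<alpha> "\<alpha> + y"] chord_arc[of \<alpha> "\<alpha> - y"] c_pos y by (intro mult_mono) auto
      then show "c\<^sup>2 * y\<^sup>2 \<le> cmod ?p * cmod ?m"
        by (simp add: power2_eq_square algebra_simps)
      show "0 < c\<^sup>2 * y\<^sup>2" using c_pos y by auto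
      show "0 \<le> (2 * K1 * M + 2 * K0 * Z2) * y\<^sup>2" using K0 K1 M Z2 by auto
    qed
    also have "\<dots> = (2 * K1 * M + 2 * K0 * Z2) / c\<^sup>2"
      using y by simp
    finally show "cmod (g (\<alpha> + y) / ?p + g (\<alpha> - y) / ?m) \<le> (2 * K1 * M + 2 * K0 * Z2) / c\<^sup>2" .
  qed
qed

text \<open>Because the symmetrised integrand is bounded, changing the truncation from \<open>p\<close> to \<open>q\<close> changes the integral by
  \<open>O(q - p)\<close>. The principal value therefore exists, with an error \<open>O(p)\<close> that is uniform on compact sets; the uniformity
  is what later permits differentiation of the limit.\<close>

lemma truncated_tendsto_pv:
  assumes g: "square_integrable g" and g': "\<And>\<alpha>. (g has_vector_derivative g' \<alpha>) (at \<alpha>)" "continuous_on UNIV g'"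
  obtains C where "0 < C" "\<And>\<alpha> p. \<alpha> \<in> {l..u} \<Longrightarrow> p \<in> {0<..1} \<Longrightarrow>
     cmod (truncated_Cauchy g p \<alpha> - pv_integral (\<lambda>\<beta>. g \<beta> / (z \<alpha> - z \<beta>)) \<alpha>) \<le> C * p"
    "\<And>\<alpha>. \<alpha> \<in> {l..u} \<Longrightarrow>
      ((\<lambda>p. truncated_Cauchy g p \<alpha>) \<longlongrightarrow> pv_integral (\<lambda>\<beta>. g \<beta> / (z \<alpha> - z \<beta>)) \<alpha>) (at_right 0)"
proof -
  obtain C where C: "0 < C" "\<And>\<alpha> y. \<alpha> \<in> {l..u} \<Longrightarrow> y \<in> {0<..1} \<Longrightarrow>
     cmod (g (\<alpha> + y) / (z \<alpha> - z (\<alpha> + y)) + g (\<alpha> - y) / (z \<alpha> - z (\<alpha> - y))) \<le> C"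
    using symmetrized_kernel_bounded[OF g'] by blast
  have diff: "cmod (truncated_Cauchy g p \<alpha> - truncated_Cauchy g q \<alpha>) \<le> C * (q - p)"
    if "\<alpha> \<in> {l..u}" "0 < p" "p \<le> q" "q \<le> 1" for \<alpha> p q
    unfolding truncated_diff(1)[OF g that(2,3)]
    using that by (intro norm_set_integral_interval_le truncated_diff(2) g C(2)) auto
  have lim: "((\<lambda>p. truncated_Cauchy g p \<alpha>) \<longlongrightarrow> pv_integral (\<lambda>\<beta>. g \<beta> / (z \<alpha> - z \<beta>)) \<alpha>) (at_right 0)"
    "\<And>p. p \<in> {0<..1} \<Longrightarrow>
        cmod (truncated_Cauchy g p \<alpha> - pv_integral (\<lambda>\<beta>. g \<beta> / (z \<alpha> - z \<beta>)) \<alpha>) \<le> C * p"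
    if \<alpha>: "\<alpha> \<in> {l..u}" for \<alpha>
  proof -
    define q where "q n = inverse (real (Suc n))" for n
    have q: "0 < q n" "q n \<le> 1" for n
      by (auto simp: q_def field_simps)
    have q0: "q \<longlonglongrightarrow> 0"
      unfolding q_def by (rule LIMSEQ_inverse_real_of_nat)
    have close: "cmod (truncated_Cauchy g (q m) \<alpha> - truncated_Cauchy g (q n) \<alpha>) \<le> C * \<bar>q m - q n\<bar>" for m n
      using diff[OF \<alpha> q(1)[of m], of "q n"] diff[OF \<alpha> q(1)[of n], of "q m"] q
      by (cases "q m \<le> q n") (auto simp: norm_minus_commute)
    have "Cauchy (\<lambda>n. truncated_Cauchy g (q n) \<alpha>)"
    proof (rule metric_CauchyI)
      fix e :: real assume "0 < e"
      then have "0 < e / C" using C by simp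
      from metric_CauchyD[OF LIMSEQ_imp_Cauchy[OF q0] this]
      obtain N where "\<And>m n. m \<ge> N \<Longrightarrow> n \<ge> N \<Longrightarrow> \<bar>q m - q n\<bar> < e / C"
        by (auto simp: dist_real_def)
      then have "cmod (truncated_Cauchy g (q m) \<alpha> - truncated_Cauchy g (q n) \<alpha>) < e" if "m \<ge> N" "n \<ge> N" for m n
        using close[of m n] that C(1) by (smt (verit) mult.commute pos_less_divide_eq)
      then show "\<exists>N. \<forall>m\<ge>N. \<forall>n\<ge>N. dist (truncated_Cauchy g (q m) \<alpha>) (truncated_Cauchy g (q n) \<alpha>) < e"
        by (auto simp: dist_norm)
    qed
    then obtain L where L: "(\<lambda>n. truncated_Cauchy g (q n) \<alpha>) \<longlonglongrightarrow> L"
      using Cauchy_convergent convergent_def by blast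
    have est: "cmod (truncated_Cauchy g p \<alpha> - L) \<le> C * p" if p: "p \<in> {0<..1}" for p
    proof (rule tendsto_upperbound)
      show "((\<lambda>n. cmod (truncated_Cauchy g p \<alpha> - truncated_Cauchy g (q n) \<alpha>)) \<longlongrightarrow> cmod (truncated_Cauchy g p \<alpha> - L)) sequentially"
        by (intro tendsto_intros L)
      have "eventually (\<lambda>n. q n < p) sequentially"
        using order_tendstoD(2)[OF q0, of p] p by auto
      then show "eventually (\<lambda>n. cmod (truncated_Cauchy g p \<alpha> - truncated_Cauchy g (q n) \<alpha>) \<le> C * p) sequentially"
      proof eventually_elim
        case (elim n)
        have "cmod (truncated_Cauchy g (q n) \<alpha> - truncated_Cauchy g p \<alpha>) \<le> C * (p - q n)"
          using elim p q by (intro diff[OF \<alpha>]) auto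
        also have "\<dots> \<le> C * p" using C(1) q[of n] by simp
        finally show ?case by (simp add: norm_minus_commute)
      qed
    qed simp
    have "((\<lambda>p. truncated_Cauchy g p \<alpha>) \<longlongrightarrow> L) (at_right 0)"
    proof (rule Lim_null_comparison[THEN Lim_null[THEN iffD2]])
      show "eventually (\<lambda>p. cmod (truncated_Cauchy g p \<alpha> - L) \<le> C * p) (at_right 0)"
        unfolding eventually_at_right_field using est by (intro exI[of _ 1]) auto
      show "((\<lambda>p. C * p) \<longlongrightarrow> 0) (at_right 0)"
        by (auto intro!: tendsto_eq_intros)
    qed
    moreover from this have "pv_integral (\<lambda>\<beta>. g \<beta> / (z \<alpha> - z \<beta>)) \<alpha> = L"
      unfolding pv_integral_def truncated_Cauchy_def by (intro tendsto_Lim) auto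
    ultimately show "((\<lambda>p. truncated_Cauchy g p \<alpha>) \<longlongrightarrow> pv_integral (\<lambda>\<beta>. g \<beta> / (z \<alpha> - z \<beta>)) \<alpha>) (at_right 0)"
     "\<And>p. p \<in> {0<..1} \<Longrightarrow>
        cmod (truncated_Cauchy g p \<alpha> - pv_integral (\<lambda>\<beta>. g \<beta> / (z \<alpha> - z \<beta>)) \<alpha>) \<le> C * p"
      using est by auto
  qed
  show ?thesis
    by (rule that[OF C(1)]) (use lim in auto)
qed

end

section \<open>Calculus on half-lines\<close>

lemma set_integral_atMost_has_vector_derivative:
  fixes h :: "real \<Rightarrow> 'a::euclidean_space"
  assumes h: "set_integrable lborel {..b} h" and cont: "continuous_on {a..b} h" and x: "a < x" "x < b"
  shows "((\<lambda>y. LBINT t:{..y}. h t) has_vector_derivative h x) (at x)"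
proof (rule has_vector_derivative_transform_within_open[where S = "{a<..<b}"])
  have "((\<lambda>y. integral {a..y} h) has_vector_derivative h x) (at x within {a..b})"
    using cont x by (intro integral_has_vector_derivative) auto
  then have "((\<lambda>y. integral {a..y} h) has_vector_derivative h x) (at x)"
    using x at_within_interior[of x "{a..b}"] by simp
  then show "((\<lambda>y. (LBINT t:{..a}. h t) + integral {a..y} h) has_vector_derivative h x) (at x)"
    by (auto intro!: derivative_eq_intros)
  fix y assume y: "y \<in> {a<..<b}"
  have "(LBINT t:{..y}. h t) = (LBINT t:{..a} \<union> {a<..y}. h t)"
    using y by (intro arg_cong[where f = "\<lambda>A. LBINT t:A. h t"]) auto
  also have "\<dots> = (LBINT t:{..a}. h t) + (LBINT t:{a<..y}. h t)"
    using y by (intro set_integral_Un set_integrable_subset[OF h]) auto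
  also have "(LBINT t:{a<..y}. h t) = (LBINT t:{a..y}. h t)"
    by (rule set_integral_discrete_difference[where X = "{a}"]) auto
  also have "\<dots> = integral {a..y} h"
    using y by (intro set_borel_integral_eq_integral set_integrable_subset[OF h]) auto
  finally show "(LBINT t:{..a}. h t) + integral {a..y} h = (LBINT t:{..y}. h t)" ..
qed (use x in auto)

lemma set_integral_atLeast_has_vector_derivative:
  fixes h :: "real \<Rightarrow> 'a::euclidean_space"
  assumes h: "set_integrable lborel {a..} h" and cont: "continuous_on {a..b} h" and x: "a < x" "x < b"
  shows "((\<lambda>y. LBINT t:{y..}. h t) has_vector_derivative - h x) (at x)"
proof (rule has_vector_derivative_transform_within_open[where S = "{a<..<b}"])
  have "((\<lambda>y. integral {a..y} h) has_vector_derivative h x) (at x within {a..b})"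
    using cont x by (intro integral_has_vector_derivative) auto
  then have "((\<lambda>y. integral {a..y} h) has_vector_derivative h x) (at x)"
    using x at_within_interior[of x "{a..b}"] by simp
  then show "((\<lambda>y. (LBINT t:{a..}. h t) - integral {a..y} h) has_vector_derivative - h x) (at x)"
    by (auto intro!: derivative_eq_intros)
  fix y assume y: "y \<in> {a<..<b}"
  have "(LBINT t:{a..}. h t) = (LBINT t:{a..<y} \<union> {y..}. h t)"
    using y by (intro arg_cong[where f = "\<lambda>A. LBINT t:A. h t"]) auto
  also have "\<dots> = (LBINT t:{a..<y}. h t) + (LBINT t:{y..}. h t)"
    using y by (intro set_integral_Un set_integrable_subset[OF h]) auto
  also have "(LBINT t:{a..<y}. h t) = (LBINT t:{a..y}. h t)"
    by (rule set_integral_discrete_difference[where X = "{y}"]) auto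
  also have "\<dots> = integral {a..y} h"
    using y by (intro set_borel_integral_eq_integral set_integrable_subset[OF h]) auto
  finally show "(LBINT t:{a..}. h t) - integral {a..y} h = (LBINT t:{y..}. h t)" 
    by simp
qed (use x in auto)

text \<open>The function \<open>\<bar>f\<bar>\<^sup>2\<close> has derivative \<open>2 f \<bullet> f'\<close>, dominated by the integrable \<open>\<bar>f\<bar>\<^sup>2 + \<bar>f'\<bar>\<^sup>2\<close>.
  Boundedness gives the vanishing boundary values at infinity in the integration by parts.\<close>

lemma square_integrable_derivative_imp_bounded:
  fixes f :: "real \<Rightarrow> complex"
  assumes f: "square_integrable f" and f': "\<And>x. (f has_vector_derivative f' x) (at x)"
    "continuous_on UNIV f'" "square_integrable f'"
  shows "bounded (range f)"
proof -
  let ?w = "\<lambda>x. (cmod (f x))\<^sup>2 + (cmod (f' x))\<^sup>2"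
  have cf: "continuous_on UNIV f"
    using f' by (auto intro!: continuous_at_imp_continuous_on has_vector_derivative_continuous)
  have w: "integrable lborel ?w"
    using f f' by (auto simp: square_integrable_def)
  have osc: "\<bar>f b \<bullet> f b - f a \<bullet> f a\<bar> \<le> integral\<^sup>L lborel ?w" if "a \<le> b" for a b
  proof -
    have "f b \<bullet> f b - f a \<bullet> f a = (\<integral>x. indicator {a..b} x *\<^sub>R (2 * (f x \<bullet> f' x)) \<partial>lborel)"
    proof (rule integral_FTC_atLeastAtMost[symmetric, OF that])
      show "((\<lambda>x. f x \<bullet> f x) has_vector_derivative 2 * (f x \<bullet> f' x)) (at x within {a..b})" for x
      proof -
        have "((\<lambda>x. f x \<bullet> f x) has_vector_derivative f x \<bullet> f' x + f' x \<bullet> f x) (at x)"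
          by (rule bounded_bilinear.has_vector_derivative[OF bounded_bilinear_inner f'(1) f'(1)])
        then show ?thesis
          by (auto simp: inner_commute intro: has_vector_derivative_at_within)
      qed
      show "continuous_on {a..b} (\<lambda>x. 2 * (f x \<bullet> f' x))"
        using cf f'(2) by (auto intro!: continuous_intros intro: continuous_on_subset)
    qed
    also have "\<bar>\<dots>\<bar> \<le> (\<integral>x. ?w x \<partial>lborel)"
      unfolding real_norm_def[symmetric]
    proof (rule Bochner_Integration.integral_norm_bound_integral[OF _ w])
      show "integrable lborel (\<lambda>x. indicator {a..b} x *\<^sub>R (2 * (f x \<bullet> f' x)))"
        unfolding set_integrable_def[symmetric] using cf f'(2)
        by (intro borel_integrable_atLeastAtMost' continuous_intros) (auto intro: continuous_on_subset)
      fix x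
      have "\<bar>2 * (f x \<bullet> f' x)\<bar> \<le> 2 * cmod (f x) * cmod (f' x)"
        using Cauchy_Schwarz_ineq2[of "f x" "f' x"] by simp
      also have "\<dots> \<le> ?w x"
        by (rule sum_squares_bound)
      finally show "norm (indicator {a..b} x *\<^sub>R (2 * (f x \<bullet> f' x))) \<le> ?w x"
        by (auto simp: indicator_def)
    qed
    finally show ?thesis .
  qed
  have "(cmod (f x))\<^sup>2 \<le> (cmod (f 0))\<^sup>2 + integral\<^sup>L lborel ?w" for x
    using osc[of 0 x] osc[of x 0] by (cases "0 \<le> x") (auto simp: dot_square_norm)
  then have "cmod (f x) \<le> sqrt ((cmod (f 0))\<^sup>2 + integral\<^sup>L lborel ?w)" for x
    using real_le_rsqrt by blast
  then show ?thesis
    unfolding bounded_iff by blast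
qed

lemma has_vector_derivative_iff_slope:
  "(f has_vector_derivative D) (at a) \<longleftrightarrow> ((\<lambda>x. (f x - f a) /\<^sub>R (x - a)) \<longlongrightarrow> D) (at a)"
proof -
  have "norm ((f x - f a) /\<^sub>R (x - a) - D) = norm (f x - f a - (x - a) *\<^sub>R D) / norm (x - a)" if "x \<noteq> a" for x
  proof -
    have "(f x - f a) /\<^sub>R (x - a) - D = (f x - f a - (x - a) *\<^sub>R D) /\<^sub>R (x - a)"
      using that by (simp add: scaleR_diff_right)
    then show ?thesis
      by (simp add: divide_inverse mult.commute)
  qed
  then have "((\<lambda>x. norm ((f x - f a) /\<^sub>R (x - a) - D)) \<longlongrightarrow> 0) (at a) \<longleftrightarrow>
    ((\<lambda>x. norm (f x - f a - (x - a) *\<^sub>R D) / norm (x - a)) \<longlongrightarrow> 0) (at a)"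
    by (intro tendsto_cong) (auto simp: eventually_at_filter)
  then show ?thesis
    unfolding has_vector_derivative_def has_derivative_iff_norm
    by (subst Lim_null) (simp add: tendsto_norm_zero_iff bounded_linear_scaleR_left)
qed

text \<open>The difference quotient of the product at \<open>a\<close> is that of \<open>f\<close> times \<open>J\<close>, so a limit of \<open>J\<close> suffices.\<close>

lemma has_vector_derivative_mult_vanishing:
  fixes f J :: "real \<Rightarrow> complex"
  assumes "(f has_vector_derivative f') (at a)" "f a = 0" "(J \<longlongrightarrow> l) (at a)"
  shows "((\<lambda>x. f x * J x) has_vector_derivative f' * l) (at a)"
proof -
  have "((\<lambda>x. (f x - f a) /\<^sub>R (x - a) * J x) \<longlongrightarrow> f' * l) (at a)"
    by (rule tendsto_mult[OF assms(1)[unfolded has_vector_derivative_iff_slope] assms(3)])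
  then show ?thesis
    using assms(2) by (simp add: has_vector_derivative_iff_slope scaleR_conv_of_real mult_ac)
qed

lemma has_vector_derivative_quotient:
  fixes f g :: "real \<Rightarrow> complex"
  assumes "(f has_vector_derivative f') (at x)" "(g has_vector_derivative g') (at x)" "g x \<noteq> 0"
  shows "((\<lambda>x. f x / g x) has_vector_derivative (f' * g x - f x * g') / (g x)\<^sup>2) (at x)"
  using has_derivative_divide'[OF assms(1,2)[unfolded has_vector_derivative_def] assms(3)]
  using assms(3) unfolding has_vector_derivative_def
  by (simp add: power2_eq_square scaleR_conv_of_real diff_divide_distrib right_diff_distrib mult_ac)

section \<open>Differentiating the Hilbert transform\<close>

context chord_arc_curve begin

lemma set_integrable_Cauchy_kernel2:
  assumes "square_integrable g" "0 < \<epsilon>"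
  shows "set_integrable lborel {\<beta>. \<epsilon> \<le> \<bar>\<beta> - \<alpha>\<bar>} (\<lambda>\<beta>. g \<beta> / (z \<alpha> - z \<beta>)\<^sup>2)"
proof -
  have "cmod (1 / (z \<alpha> - z \<beta>)\<^sup>2) \<le> 1 / (c\<^sup>2 * \<epsilon>) / \<bar>\<beta> - \<alpha>\<bar>" if "\<epsilon> \<le> \<bar>\<beta> - \<alpha>\<bar>" for \<beta>
  proof -
    have "cmod (1 / (z \<alpha> - z \<beta>)) * cmod (1 / (z \<alpha> - z \<beta>)) \<le> (1 / c / \<epsilon>) * (1 / c / \<bar>\<beta> - \<alpha>\<bar>)"
    proof (rule mult_mono)
      have "1 / c / \<bar>\<beta> - \<alpha>\<bar> \<le> 1 / c / \<epsilon>"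
        using that assms(2) c_pos by (intro divide_left_mono mult_pos_pos) auto
      then show "cmod (1 / (z \<alpha> - z \<beta>)) \<le> 1 / c / \<epsilon>"
        using Cauchy_kernel_bound order_trans by blast
    qed (use Cauchy_kernel_bound assms(2) c_pos in auto)
    then show ?thesis
      by (simp add: norm_mult[symmetric] power2_eq_square mult_ac)
  qed
  from set_integrable_square_integrable_mult[OF assms(1) _ assms(2) this] show ?thesis
    by simp
qed

text \<open>Dominated convergence: for \<open>x\<close> near \<open>\<alpha>\<close> all the excised intervals contain the \<open>\<epsilon>/2\<close>-neighbourhood of \<open>\<alpha>\<close>, and the
  indicators of the truncation sets converge off the two points \<open>\<alpha> \<plusminus> \<epsilon>\<close>.\<close>

lemma tendsto_translated_truncated_integral:
  assumes \<phi>: "square_integrable \<phi>" and \<epsilon>: "0 < \<epsilon>"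
  shows "((\<lambda>x. LBINT \<beta>:{\<beta>. \<epsilon> \<le> \<bar>\<beta> - x\<bar>}. \<phi> \<beta> / ((z x - z \<beta>) * (z \<alpha> - z \<beta>)))
      \<longlongrightarrow> (LBINT \<beta>:{\<beta>. \<epsilon> \<le> \<bar>\<beta> - \<alpha>\<bar>}. \<phi> \<beta> / (z \<alpha> - z \<beta>)\<^sup>2)) (at \<alpha>)"
  unfolding tendsto_at_iff_sequentially
proof (intro allI impI)
  fix X :: "nat \<Rightarrow> real"
  assume "\<forall>i. X i \<in> UNIV - {\<alpha>}" and X: "X \<longlonglongrightarrow> \<alpha>"
  from X have "eventually (\<lambda>n. \<bar>X n - \<alpha>\<bar> < \<epsilon> / 2) sequentially"
    using \<epsilon> by (auto dest!: tendstoD[where e = "\<epsilon>/2"] simp: dist_real_def)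
  then obtain N where N: "\<And>n. n \<ge> N \<Longrightarrow> \<bar>X n - \<alpha>\<bar> < \<epsilon> / 2"
    by (auto simp: eventually_sequentially)
  \<comment> \<open>A dominating function: the first factor bounds the translated kernel on its own truncation set, the second
    the kernel centred at \<open>\<alpha>\<close>.\<close>
  define W where "W \<beta> = indicator {\<beta>. \<epsilon>/2 \<le> \<bar>\<beta> - \<alpha>\<bar>} \<beta> *\<^sub>R (\<phi> \<beta> * complex_of_real (1 / c / \<epsilon> * (1 / c / \<bar>\<beta> - \<alpha>\<bar>)))" for \<beta>
  have [measurable]: "\<phi> \<in> borel_measurable borel"
    using \<phi> by (simp add: square_integrable_def)
  have "integrable lborel W"
    unfolding W_def set_integrable_def[symmetric] using \<epsilon> c_pos
    by (intro set_integrable_square_integrable_mult[OF \<phi>, where B = "1 / c / \<epsilon> * (1 / c)"]) 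
      (auto simp: norm_mult norm_divide)
  then have W: "integrable lborel (\<lambda>\<beta>. cmod (W \<beta>))"
    by simp
  show "((\<lambda>x. LBINT \<beta>:{\<beta>. \<epsilon> \<le> \<bar>\<beta> - x\<bar>}. \<phi> \<beta> / ((z x - z \<beta>) * (z \<alpha> - z \<beta>))) \<circ> X)
      \<longlonglongrightarrow> (LBINT \<beta>:{\<beta>. \<epsilon> \<le> \<bar>\<beta> - \<alpha>\<bar>}. \<phi> \<beta> / (z \<alpha> - z \<beta>)\<^sup>2)"
  proof (rule LIMSEQ_offset[where k = N], unfold set_lebesgue_integral_def o_def,
      rule integral_dominated_convergence[OF _ _ W])
    show "AE \<beta> in lborel. norm (indicat_real {\<beta>. \<epsilon> \<le> \<bar>\<beta> - X (i + N)\<bar>} \<beta> *\<^sub>R (\<phi> \<beta> / ((z (X (i + N)) - z \<beta>) * (z \<alpha> - z \<beta>))))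
        \<le> cmod (W \<beta>)" for i
    proof (intro AE_I2)
      fix \<beta>
      let ?x = "X (i + N)"
      have x: "\<bar>?x - \<alpha>\<bar> < \<epsilon> / 2" by (rule N) simp
      have "cmod (\<phi> \<beta> / ((z ?x - z \<beta>) * (z \<alpha> - z \<beta>))) \<le> cmod (W \<beta>)" if \<beta>: "\<epsilon> \<le> \<bar>\<beta> - ?x\<bar>"
      proof -
        have far: "\<epsilon> / 2 \<le> \<bar>\<beta> - \<alpha>\<bar>"
          using \<beta> x by (simp add: abs_if split: if_splits)
        have "cmod (\<phi> \<beta>) * (cmod (1 / (z ?x - z \<beta>)) * cmod (1 / (z \<alpha> - z \<beta>))) 
          \<le> cmod (\<phi> \<beta>) * ((1 / c / \<epsilon>) * (1 / c / \<bar>\<beta> - \<alpha>\<bar>))"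
        proof (intro mult_left_mono mult_mono)
          have "1 / c / \<bar>\<beta> - ?x\<bar> \<le> 1 / c / \<epsilon>"
            using \<beta> \<epsilon> c_pos by (intro divide_left_mono mult_pos_pos) auto
          then show "cmod (1 / (z ?x - z \<beta>)) \<le> 1 / c / \<epsilon>"
            using Cauchy_kernel_bound order_trans by blast
        qed (use Cauchy_kernel_bound \<epsilon> c_pos in auto)
        also have "\<dots> = cmod (W \<beta>)"
          using far c_pos \<epsilon> by (simp add: W_def norm_mult norm_divide)
        finally show ?thesis
          by (simp add: norm_mult norm_divide)
      qed
      then show "norm (indicat_real {\<beta>. \<epsilon> \<le> \<bar>\<beta> - ?x\<bar>} \<beta> *\<^sub>R (\<phi> \<beta> / ((z ?x - z \<beta>) * (z \<alpha> - z \<beta>))))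
          \<le> cmod (W \<beta>)"
        by (auto simp: indicator_def)
    qed
    have ae: "AE \<beta> in lborel. \<beta> \<noteq> \<alpha> - \<epsilon> \<and> \<beta> \<noteq> \<alpha> + \<epsilon>"
      using AE_lborel_singleton[of "\<alpha> - \<epsilon>"] AE_lborel_singleton[of "\<alpha> + \<epsilon>"] by eventually_elim auto
    have XN: "(\<lambda>i. X (i + N)) \<longlonglongrightarrow> \<alpha>"
      using X by (rule LIMSEQ_ignore_initial_segment)
    have zX: "(\<lambda>i. z (X (i + N))) \<longlonglongrightarrow> z \<alpha>"
      using z_continuous(1) XN by (rule continuous_on_tendsto_compose) auto
    show "AE \<beta> in lborel. (\<lambda>i. indicat_real {\<beta>. \<epsilon> \<le> \<bar>\<beta> - X (i + N)\<bar>} \<beta> *\<^sub>R (\<phi> \<beta> / ((z (X (i + N)) - z \<beta>) * (z \<alpha> - z \<beta>))))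
        \<longlonglongrightarrow> indicat_real {\<beta>. \<epsilon> \<le> \<bar>\<beta> - \<alpha>\<bar>} \<beta> *\<^sub>R (\<phi> \<beta> / (z \<alpha> - z \<beta>)\<^sup>2)"
      using ae
    proof eventually_elim
      case (elim \<beta>)
      have dist: "(\<lambda>i. \<bar>\<beta> - X (i + N)\<bar>) \<longlonglongrightarrow> \<bar>\<beta> - \<alpha>\<bar>"
        by (intro tendsto_intros XN)
      show ?case
      proof (cases "\<epsilon> < \<bar>\<beta> - \<alpha>\<bar>")
        case True
        then have "z \<alpha> - z \<beta> \<noteq> 0"
          using \<epsilon> by (intro z_neq) auto
        then have "(\<lambda>i. \<phi> \<beta> / ((z (X (i + N)) - z \<beta>) * (z \<alpha> - z \<beta>))) \<longlonglongrightarrow> \<phi> \<beta> / ((z \<alpha> - z \<beta>) * (z \<alpha> - z \<beta>))"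
          by (intro tendsto_intros zX) auto
        moreover have "eventually (\<lambda>i. \<phi> \<beta> / ((z (X (i + N)) - z \<beta>) * (z \<alpha> - z \<beta>)) =
            indicat_real {\<beta>. \<epsilon> \<le> \<bar>\<beta> - X (i + N)\<bar>} \<beta> *\<^sub>R (\<phi> \<beta> / ((z (X (i + N)) - z \<beta>) * (z \<alpha> - z \<beta>)))) sequentially"
          using order_tendstoD(1)[OF dist True] by eventually_elim auto
        ultimately show ?thesis
          using True by (auto intro: Lim_transform_eventually simp: power2_eq_square)
      next
        case False
        then have less: "\<bar>\<beta> - \<alpha>\<bar> < \<epsilon>"
          using elim by auto
        have "eventually (\<lambda>i. 0 = indicat_real {\<beta>. \<epsilon> \<le> \<bar>\<beta> - X (i + N)\<bar>} \<beta> *\<^sub>R (\<phi> \<beta> / ((z (X (i + N)) - z \<beta>) * (z \<alpha> - z \<beta>)))) sequentially"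
          using order_tendstoD(2)[OF dist less] by eventually_elim auto
        then show ?thesis
          using less by (auto intro: Lim_transform_eventually)
      qed
    qed
  qed simp_all
qed

text \<open>Only the two moving end points contribute, since the kernel is frozen at \<open>\<alpha>\<close>.\<close>

lemma truncated_domain_has_vector_derivative:
  assumes \<phi>: "square_integrable \<phi>" "continuous_on UNIV \<phi>" and \<epsilon>: "0 < \<epsilon>"
  shows "((\<lambda>x. LBINT \<beta>:{\<beta>. \<epsilon> \<le> \<bar>\<beta> - x\<bar>}. \<phi> \<beta> / (z \<alpha> - z \<beta>)) has_vector_derivative
     \<phi> (\<alpha> - \<epsilon>) / (z \<alpha> - z (\<alpha> - \<epsilon>)) - \<phi> (\<alpha> + \<epsilon>) / (z \<alpha> - z (\<alpha> + \<epsilon>))) (at \<alpha>)"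
proof (rule has_vector_derivative_transform_within_open[where S = "{\<alpha>-\<epsilon>/2<..<\<alpha>+\<epsilon>/2}"])
  let ?k = "\<lambda>\<beta>. \<phi> \<beta> / (z \<alpha> - z \<beta>)"
  have int: "set_integrable lborel {\<beta>. \<epsilon>/2 \<le> \<bar>\<beta> - \<alpha>\<bar>} ?k"
    using \<epsilon> by (intro set_integrable_Cauchy_kernel \<phi>) auto
  have cont: "continuous_on {\<alpha>-2*\<epsilon>..\<alpha>-\<epsilon>/2} ?k" "continuous_on {\<alpha>+\<epsilon>/2..\<alpha>+2*\<epsilon>} ?k"
    using \<epsilon> \<phi>(2) z_continuous(1) z_neq
    by (auto intro!: continuous_intros intro: continuous_on_subset simp del: right_minus_eq)
  have d1: "((\<lambda>y. LBINT \<beta>:{..y}. ?k \<beta>) has_vector_derivative ?k (\<alpha> - \<epsilon>)) (at (\<alpha> - \<epsilon>))"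
    using \<epsilon> cont by (intro set_integral_atMost_has_vector_derivative[of "\<alpha>-\<epsilon>/2" _ "\<alpha>-2*\<epsilon>"]
      set_integrable_subset[OF int]) auto
  have d2: "((\<lambda>y. LBINT \<beta>:{y..}. ?k \<beta>) has_vector_derivative - ?k (\<alpha> + \<epsilon>)) (at (\<alpha> + \<epsilon>))"
    using \<epsilon> cont by (intro set_integral_atLeast_has_vector_derivative[of "\<alpha>+\<epsilon>/2" _ "\<alpha>+2*\<epsilon>"]
      set_integrable_subset[OF int]) auto
  have "((\<lambda>x. LBINT \<beta>:{..x-\<epsilon>}. ?k \<beta>) has_vector_derivative 1 *\<^sub>R ?k (\<alpha> - \<epsilon>)) (at \<alpha>)"
    by (rule vector_diff_chain_at[where f = "\<lambda>x. x - \<epsilon>" and g = "\<lambda>y. LBINT \<beta>:{..y}. ?k \<beta>", unfolded o_def])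
      (auto intro!: derivative_eq_intros d1)
  moreover have "((\<lambda>x. LBINT \<beta>:{x+\<epsilon>..}. ?k \<beta>) has_vector_derivative 1 *\<^sub>R (- ?k (\<alpha> + \<epsilon>))) (at \<alpha>)"
    by (rule vector_diff_chain_at[where f = "\<lambda>x. x + \<epsilon>" and g = "\<lambda>y. LBINT \<beta>:{y..}. ?k \<beta>", unfolded o_def])
      (auto intro!: derivative_eq_intros d2)
  ultimately show "((\<lambda>x. (LBINT \<beta>:{..x-\<epsilon>}. ?k \<beta>) + (LBINT \<beta>:{x+\<epsilon>..}. ?k \<beta>)) has_vector_derivative
     ?k (\<alpha> - \<epsilon>) - ?k (\<alpha> + \<epsilon>)) (at \<alpha>)"
    using has_vector_derivative_add by fastforce
  fix x assume x: "x \<in> {\<alpha>-\<epsilon>/2<..<\<alpha>+\<epsilon>/2}"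
  have eq: "{\<beta>. \<epsilon> \<le> \<bar>\<beta> - x\<bar>} = {..x-\<epsilon>} \<union> {x+\<epsilon>..}"
    using \<epsilon> by auto
  have "{..x-\<epsilon>} \<subseteq> {\<beta>. \<epsilon>/2 \<le> \<bar>\<beta> - \<alpha>\<bar>}" "{x+\<epsilon>..} \<subseteq> {\<beta>. \<epsilon>/2 \<le> \<bar>\<beta> - \<alpha>\<bar>}"
    using x by auto
  then have "set_integrable lborel {..x-\<epsilon>} ?k" "set_integrable lborel {x+\<epsilon>..} ?k"
    by (auto intro!: set_integrable_subset[OF int])
  then show "(LBINT \<beta>:{..x-\<epsilon>}. ?k \<beta>) + (LBINT \<beta>:{x+\<epsilon>..}. ?k \<beta>) = (LBINT \<beta>:{\<beta>. \<epsilon> \<le> \<bar>\<beta> - x\<bar>}. ?k \<beta>)"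
    unfolding eq using \<epsilon>
    by (subst set_integral_Un) auto
qed (use \<epsilon> in auto)

text \<open>The variable enters through the domain and through the kernel. The change of the kernel is the exact product
  \<open>(z \<alpha> - z x) / ((z x - z \<beta>) (z \<alpha> - z \<beta>))\<close>, whose first factor vanishes at \<open>x = \<alpha>\<close>: the derivative falls on
  that factor, and the remaining integral only has to converge.\<close>

lemma truncated_has_vector_derivative:
  assumes \<phi>: "square_integrable \<phi>" "continuous_on UNIV \<phi>" and \<epsilon>: "0 < \<epsilon>"
  shows "(truncated_Cauchy \<phi> \<epsilon> has_vector_derivative
     \<phi> (\<alpha> - \<epsilon>) / (z \<alpha> - z (\<alpha> - \<epsilon>)) - \<phi> (\<alpha> + \<epsilon>) / (z \<alpha> - z (\<alpha> + \<epsilon>))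
       - z' \<alpha> * (LBINT \<beta>:{\<beta>. \<epsilon> \<le> \<bar>\<beta> - \<alpha>\<bar>}. \<phi> \<beta> / (z \<alpha> - z \<beta>)\<^sup>2)) (at \<alpha>)"
proof -
  define G where "G x = (LBINT \<beta>:{\<beta>. \<epsilon> \<le> \<bar>\<beta> - x\<bar>}. \<phi> \<beta> / (z \<alpha> - z \<beta>))" for x
  define J where "J x = (LBINT \<beta>:{\<beta>. \<epsilon> \<le> \<bar>\<beta> - x\<bar>}. \<phi> \<beta> / ((z x - z \<beta>) * (z \<alpha> - z \<beta>)))" for x
  define D where "D = \<phi> (\<alpha> - \<epsilon>) / (z \<alpha> - z (\<alpha> - \<epsilon>)) - \<phi> (\<alpha> + \<epsilon>) / (z \<alpha> - z (\<alpha> + \<epsilon>))"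
  define J0 where "J0 = (LBINT \<beta>:{\<beta>. \<epsilon> \<le> \<bar>\<beta> - \<alpha>\<bar>}. \<phi> \<beta> / (z \<alpha> - z \<beta>)\<^sup>2)"
  have int: "set_integrable lborel {\<beta>. \<epsilon> \<le> \<bar>\<beta> - x\<bar>} (\<lambda>\<beta>. \<phi> \<beta> / (z x - z \<beta>))"
      "set_integrable lborel {\<beta>. \<epsilon> \<le> \<bar>\<beta> - x\<bar>} (\<lambda>\<beta>. \<phi> \<beta> / (z \<alpha> - z \<beta>))" 
    if "x \<in> {\<alpha>-\<epsilon>/2<..<\<alpha>+\<epsilon>/2}" for x
  proof -
    have "{\<beta>. \<epsilon> \<le> \<bar>\<beta> - x\<bar>} \<subseteq> {\<beta>. \<epsilon>/2 \<le> \<bar>\<beta> - \<alpha>\<bar>}"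
      using that by (auto simp: abs_if split: if_splits)
    then show "set_integrable lborel {\<beta>. \<epsilon> \<le> \<bar>\<beta> - x\<bar>} (\<lambda>\<beta>. \<phi> \<beta> / (z \<alpha> - z \<beta>))" 
      using \<epsilon> by (intro set_integrable_subset[OF set_integrable_Cauchy_kernel[OF \<phi>(1), of "\<epsilon>/2" \<alpha>]]) auto
  qed (use \<phi> \<epsilon> in \<open>auto intro: set_integrable_Cauchy_kernel\<close>)
  have "((\<lambda>x. z \<alpha> - z x) has_vector_derivative - z' \<alpha>) (at \<alpha>)"
    using z'[of \<alpha>] by (auto intro!: derivative_eq_intros)
  then have "((\<lambda>x. (z \<alpha> - z x) * J x) has_vector_derivative (- z' \<alpha>) * J0) (at \<alpha>)"
    using tendsto_translated_truncated_integral[OF \<phi>(1) \<epsilon>, of \<alpha>]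
    by (intro has_vector_derivative_mult_vanishing) (auto simp: J_def J0_def)
  moreover have "(G has_vector_derivative D) (at \<alpha>)"
    using truncated_domain_has_vector_derivative[OF assms, of \<alpha>] unfolding G_def D_def .
  ultimately have "((\<lambda>x. G x + (z \<alpha> - z x) * J x) has_vector_derivative D + (- z' \<alpha>) * J0) (at \<alpha>)"
    by (intro has_vector_derivative_add)
  then have "(truncated_Cauchy \<phi> \<epsilon> has_vector_derivative D + (- z' \<alpha>) * J0) (at \<alpha>)"
  proof (rule has_vector_derivative_transform_within_open[where S = "{\<alpha>-\<epsilon>/2<..<\<alpha>+\<epsilon>/2}"])
    fix x assume x: "x \<in> {\<alpha>-\<epsilon>/2<..<\<alpha>+\<epsilon>/2}"
    have "truncated_Cauchy \<phi> \<epsilon> x - G x = 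
        (LBINT \<beta>:{\<beta>. \<epsilon> \<le> \<bar>\<beta> - x\<bar>}. \<phi> \<beta> / (z x - z \<beta>) - \<phi> \<beta> / (z \<alpha> - z \<beta>))"
      unfolding truncated_Cauchy_def G_def using int[OF x] by (subst set_integral_diff) auto
    also have "\<dots> = (LBINT \<beta>:{\<beta>. \<epsilon> \<le> \<bar>\<beta> - x\<bar>}. (z \<alpha> - z x) * (\<phi> \<beta> / ((z x - z \<beta>) * (z \<alpha> - z \<beta>))))"
    proof (rule set_lebesgue_integral_cong)
      show "\<forall>\<beta>. \<beta> \<in> {\<beta>. \<epsilon> \<le> \<bar>\<beta> - x\<bar>} \<longrightarrow> \<phi> \<beta> / (z x - z \<beta>) - \<phi> \<beta> / (z \<alpha> - z \<beta>) =
          (z \<alpha> - z x) * (\<phi> \<beta> / ((z x - z \<beta>) * (z \<alpha> - z \<beta>)))"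
      proof (intro allI impI)
        fix \<beta> assume "\<beta> \<in> {\<beta>. \<epsilon> \<le> \<bar>\<beta> - x\<bar>}"
        then have "z x - z \<beta> \<noteq> 0" "z \<alpha> - z \<beta> \<noteq> 0"
          using x \<epsilon> by (auto intro!: z_neq simp del: right_minus_eq)
        then show "\<phi> \<beta> / (z x - z \<beta>) - \<phi> \<beta> / (z \<alpha> - z \<beta>) =
          (z \<alpha> - z x) * (\<phi> \<beta> / ((z x - z \<beta>) * (z \<alpha> - z \<beta>)))"
          by (simp add: field_simps)
      qed
    qed simp
    also have "\<dots> = (z \<alpha> - z x) * J x"
      unfolding J_def by (rule set_integral_mult_right)
    finally show "G x + (z \<alpha> - z x) * J x = truncated_Cauchy \<phi> \<epsilon> x"
      by (simp add: algebra_simps)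
  qed (use \<epsilon> in auto)
  then show ?thesis
    by (simp add: D_def J0_def)
qed

lemma square_integrable_mult_z':
  assumes "square_integrable f"
  shows "square_integrable (\<lambda>\<beta>. f \<beta> * z' \<beta>)"
  unfolding square_integrable_def
proof
  have [measurable]: "f \<in> borel_measurable borel"
    using assms by (simp add: square_integrable_def)
  show "(\<lambda>\<beta>. f \<beta> * z' \<beta>) \<in> borel_measurable lborel"
    by measurable
  have "integrable lborel (\<lambda>x. M\<^sup>2 * (cmod (f x))\<^sup>2)"
    using assms by (simp add: square_integrable_def)
  then show "integrable lborel (\<lambda>x. (cmod (f x * z' x))\<^sup>2)"
  proof (rule Bochner_Integration.integrable_bound)
    have "(cmod (f x * z' x))\<^sup>2 \<le> M\<^sup>2 * (cmod (f x))\<^sup>2" for x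
      unfolding norm_mult power_mult_distrib
      using power_mono[OF z'_bounded[of x], of 2] by (subst mult.commute) (auto intro: mult_right_mono)
    then show "AE x in lborel. norm ((cmod (f x * z' x))\<^sup>2) \<le> norm (M\<^sup>2 * (cmod (f x))\<^sup>2)"
      by auto
  qed measurable
qed

text \<open>The integrand of the sum on the left is the exact derivative of \<open>f \<beta> / (z \<alpha> - z \<beta>)\<close>, which tends to \<open>0\<close> at infinity.\<close>

lemma truncated_by_parts:
  assumes f: "square_integrable f" "\<And>x. (f has_vector_derivative f' x) (at x)"
    and f': "continuous_on UNIV f'" "square_integrable f'" and \<epsilon>: "0 < \<epsilon>"
  shows "(LBINT \<beta>:{\<beta>. \<epsilon> \<le> \<bar>\<beta> - \<alpha>\<bar>}. f \<beta> * z' \<beta> / (z \<alpha> - z \<beta>)\<^sup>2) + truncated_Cauchy f' \<epsilon> \<alpha> =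
    f (\<alpha> - \<epsilon>) / (z \<alpha> - z (\<alpha> - \<epsilon>)) - f (\<alpha> + \<epsilon>) / (z \<alpha> - z (\<alpha> + \<epsilon>))"
proof -
  let ?S = "{\<beta>. \<epsilon> \<le> \<bar>\<beta> - \<alpha>\<bar>}"
  let ?F = "\<lambda>\<beta>. f \<beta> / (z \<alpha> - z \<beta>)"
  let ?h = "\<lambda>\<beta>. f \<beta> * z' \<beta> / (z \<alpha> - z \<beta>)\<^sup>2 + f' \<beta> / (z \<alpha> - z \<beta>)"
  have cf: "continuous_on UNIV f"
    using f by (auto intro!: continuous_at_imp_continuous_on has_vector_derivative_continuous)
  have fz': "square_integrable (\<lambda>\<beta>. f \<beta> * z' \<beta>)"
    by (rule square_integrable_mult_z') (rule f)
  have int: "set_integrable lborel ?S (\<lambda>\<beta>. f \<beta> * z' \<beta> / (z \<alpha> - z \<beta>)\<^sup>2)"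
      "set_integrable lborel ?S (\<lambda>\<beta>. f' \<beta> / (z \<alpha> - z \<beta>))"
    using set_integrable_Cauchy_kernel2[OF fz' \<epsilon>] set_integrable_Cauchy_kernel[OF f'(2) \<epsilon>] by auto
  then have inth: "set_integrable lborel ?S ?h"
    by (rule set_integral_add)
  have deriv: "(?F has_vector_derivative ?h \<beta>) (at \<beta>)" and isCont: "isCont ?h \<beta>" if "\<beta> \<noteq> \<alpha>" for \<beta>
  proof -
    have nz: "z \<alpha> - z \<beta> \<noteq> 0"
      using that by (intro z_neq) auto
    have "((\<lambda>\<beta>. z \<alpha> - z \<beta>) has_vector_derivative - z' \<beta>) (at \<beta>)"
      using z'[of \<beta>] by (auto intro!: derivative_eq_intros)
    from has_vector_derivative_quotient[OF f(2)[of \<beta>] this nz]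
    have "(?F has_vector_derivative (f' \<beta> * (z \<alpha> - z \<beta>) + f \<beta> * z' \<beta>) / (z \<alpha> - z \<beta>)\<^sup>2) (at \<beta>)"
      by simp
    also have "(f' \<beta> * (z \<alpha> - z \<beta>) + f \<beta> * z' \<beta>) / (z \<alpha> - z \<beta>)\<^sup>2 = ?h \<beta>"
      using nz by (simp add: add_divide_distrib power2_eq_square)
    finally show "(?F has_vector_derivative ?h \<beta>) (at \<beta>)" .
    show "isCont ?h \<beta>"
      using nz cf f'(1) z_continuous by (auto intro!: continuous_intros simp: continuous_on_eq_continuous_at)
  qed
  have "bounded (range f)"
    using square_integrable_derivative_imp_bounded[OF f f'] .
  then obtain B where B: "\<And>x. cmod (f x) \<le> B"
    unfolding bounded_iff by auto
  have F_bound: "cmod (?F \<beta>) \<le> B / c / \<bar>\<beta> - \<alpha>\<bar>" for \<beta>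
  proof -
    have "cmod (?F \<beta>) = cmod (f \<beta>) * cmod (1 / (z \<alpha> - z \<beta>))"
      by (simp add: norm_divide)
    also have "\<dots> \<le> B * (1 / c / \<bar>\<beta> - \<alpha>\<bar>)"
      using B[of \<beta>] norm_ge_zero[of "f \<beta>"] by (intro mult_mono B Cauchy_kernel_bound) (linarith, simp)
    finally show ?thesis by simp
  qed
  have lim: "(?F \<longlongrightarrow> 0) at_bot" "(?F \<longlongrightarrow> 0) at_top"
    by (rule Lim_null_comparison[OF always_eventually[OF allI[OF F_bound]]], real_asymp)+
  have L: "(LBINT \<beta>:{..\<alpha>-\<epsilon>}. ?h \<beta>) = ?F (\<alpha> - \<epsilon>)"
  proof -
    have "(LBINT \<beta>=-\<infinity>..ereal (\<alpha>-\<epsilon>). ?h \<beta>) = ?F (\<alpha> - \<epsilon>) - 0"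
    proof (rule interval_integral_FTC_integrable)
      show "set_integrable lborel (einterval (-\<infinity>) (ereal (\<alpha>-\<epsilon>))) ?h"
        by (rule set_integrable_subset[OF inth]) (auto simp: einterval_iff)
      show "((?F \<circ> real_of_ereal) \<longlongrightarrow> 0) (at_right (-\<infinity>))"
        unfolding ereal_tendsto_simps by (rule lim)
      have "isCont ?F (\<alpha> - \<epsilon>)"
        using deriv[of "\<alpha> - \<epsilon>"] \<epsilon> by (auto intro: has_vector_derivative_continuous)
      then show "((?F \<circ> real_of_ereal) \<longlongrightarrow> ?F (\<alpha> - \<epsilon>)) (at_left (ereal (\<alpha>-\<epsilon>)))"
        unfolding ereal_tendsto_simps isCont_def by (rule filterlim_mono) (auto simp: at_le)
    qed (use \<epsilon> in \<open>auto intro!: deriv isCont\<close>)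
    moreover have "(LBINT \<beta>=-\<infinity>..ereal (\<alpha>-\<epsilon>). ?h \<beta>) = (LBINT \<beta>:{..\<alpha>-\<epsilon>}. ?h \<beta>)"
      by (auto intro!: set_integral_discrete_difference[where X = "{\<alpha>-\<epsilon>}"]
        simp: interval_lebesgue_integral_def einterval_iff)
    ultimately show ?thesis by simp
  qed
  have R: "(LBINT \<beta>:{\<alpha>+\<epsilon>..}. ?h \<beta>) = - ?F (\<alpha> + \<epsilon>)"
  proof -
    have "(LBINT \<beta>=ereal (\<alpha>+\<epsilon>)..\<infinity>. ?h \<beta>) = 0 - ?F (\<alpha> + \<epsilon>)"
    proof (rule interval_integral_FTC_integrable)
      show "set_integrable lborel (einterval (ereal (\<alpha>+\<epsilon>)) \<infinity>) ?h"
        by (rule set_integrable_subset[OF inth]) (auto simp: einterval_iff)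
      show "((?F \<circ> real_of_ereal) \<longlongrightarrow> 0) (at_left \<infinity>)"
        unfolding ereal_tendsto_simps by (rule lim)
      have "isCont ?F (\<alpha> + \<epsilon>)"
        using deriv[of "\<alpha> + \<epsilon>"] \<epsilon> by (auto intro: has_vector_derivative_continuous)
      then show "((?F \<circ> real_of_ereal) \<longlongrightarrow> ?F (\<alpha> + \<epsilon>)) (at_right (ereal (\<alpha>+\<epsilon>)))"
        unfolding ereal_tendsto_simps isCont_def by (rule filterlim_mono) (auto simp: at_le)
    qed (use \<epsilon> in \<open>auto intro!: deriv isCont\<close>)
    moreover have "(LBINT \<beta>=ereal (\<alpha>+\<epsilon>)..\<infinity>. ?h \<beta>) = (LBINT \<beta>:{\<alpha>+\<epsilon>..}. ?h \<beta>)"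
      by (auto intro!: set_integral_discrete_difference[where X = "{\<alpha>+\<epsilon>}"]
        simp: interval_lebesgue_integral_def einterval_iff)
    ultimately show ?thesis by simp
  qed
  have S: "?S = {..\<alpha>-\<epsilon>} \<union> {\<alpha>+\<epsilon>..}"
    using \<epsilon> by auto
  have "(LBINT \<beta>:?S. f \<beta> * z' \<beta> / (z \<alpha> - z \<beta>)\<^sup>2) + truncated_Cauchy f' \<epsilon> \<alpha> = (LBINT \<beta>:?S. ?h \<beta>)"
    unfolding truncated_Cauchy_def using int by (subst set_integral_add) auto
  also have "\<dots> = (LBINT \<beta>:{..\<alpha>-\<epsilon>}. ?h \<beta>) + (LBINT \<beta>:{\<alpha>+\<epsilon>..}. ?h \<beta>)"
    unfolding S using \<epsilon> by (intro set_integral_Un set_integrable_subset[OF inth]) auto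
  finally show ?thesis
    unfolding L R by simp
qed


text \<open>Each of the two terms tends to \<open>- f \<alpha> * z'' \<alpha> / z' \<alpha>\<close>, so the difference tends to \<open>0\<close>. Over the common denominator, of
  size \<open>\<epsilon>\<^sup>2\<close>, the numerator consists of first and second differences of \<open>f\<close>, \<open>z\<close> and \<open>z'\<close> of total order \<open>\<epsilon>^3\<close>.\<close>

lemma boundary_terms_cancel:
  assumes f': "\<And>\<alpha>. (f has_vector_derivative f' \<alpha>) (at \<alpha>)" and "continuous_on UNIV f'"
  obtains C where "0 < C" "\<And>\<alpha> \<epsilon>. \<alpha> \<in> {l..u} \<Longrightarrow> \<epsilon> \<in> {0<..1} \<Longrightarrow>
     cmod (f (\<alpha> - \<epsilon>) * (z' (\<alpha> - \<epsilon>) - z' \<alpha>) / (z \<alpha> - z (\<alpha> - \<epsilon>))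
       - f (\<alpha> + \<epsilon>) * (z' (\<alpha> + \<epsilon>) - z' \<alpha>) / (z \<alpha> - z (\<alpha> + \<epsilon>))) \<le> C * \<epsilon>"
proof -
  have cf: "continuous_on UNIV f"
    using f' by (auto intro!: continuous_at_imp_continuous_on has_vector_derivative_continuous)
  obtain K0 where K0: "0 < K0" "\<And>x. x \<in> {l-1..u+1} \<Longrightarrow> norm (f x) \<le> K0"
    using continuous_bounded_on_interval[OF cf] by blast
  obtain K1 where K1: "0 < K1" "\<And>x. x \<in> {l-1..u+1} \<Longrightarrow> norm (f' x) \<le> K1"
    using continuous_bounded_on_interval[OF assms(2)] by blast
  obtain Z2 where Z2: "0 < Z2" "\<And>x. x \<in> {l-1..u+1} \<Longrightarrow> norm (z'' x) \<le> Z2"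
    using continuous_bounded_on_interval[OF z_continuous(3)] by blast
  obtain Z3 where Z3: "0 < Z3" "\<And>x. x \<in> {l-1..u+1} \<Longrightarrow> norm (z''' x) \<le> Z3"
    using continuous_bounded_on_interval[OF continuous_z'''] by blast
  have M: "0 \<le> M"
    using z'_bounded[of 0] norm_ge_zero order_trans by blast
  let ?K = "2 * K1 * Z2 * M + K0 * (2 * Z2 * Z2 + 2 * Z3 * M)"
  show ?thesis
  proof
    show "0 < ?K / c\<^sup>2"
      using c_pos M K0 K1 Z2 Z3
      by (intro divide_pos_pos[OF add_nonneg_pos] mult_pos_pos[OF _ add_pos_nonneg]) auto
    fix \<alpha> \<epsilon> assume \<alpha>: "\<alpha> \<in> {l..u}" and \<epsilon>: "\<epsilon> \<in> {0<..(1::real)}"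
    define dp dm ap am where "dp = z \<alpha> - z (\<alpha> + \<epsilon>)" and "dm = z \<alpha> - z (\<alpha> - \<epsilon>)"
      and "ap = z' (\<alpha> + \<epsilon>) - z' \<alpha>" and "am = z' (\<alpha> - \<epsilon>) - z' \<alpha>"
    have nz: "dp \<noteq> 0" "dm \<noteq> 0"
      unfolding dp_def dm_def using \<epsilon> by (auto intro!: z_neq simp del: right_minus_eq)
    have 1: "cmod (f (\<alpha> - \<epsilon>) - f (\<alpha> + \<epsilon>)) \<le> 2 * K1 * \<epsilon>"
    proof -
      have "cmod (f (\<alpha> - \<epsilon>) - f (\<alpha> + \<epsilon>)) \<le> K1 * \<bar>(\<alpha> - \<epsilon>) - (\<alpha> + \<epsilon>)\<bar>"
        using \<alpha> \<epsilon> by (intro vector_derivative_imp_Lipschitz[of "l-1" "u+1" f f']) (auto intro: f' K1)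
      then show ?thesis using \<epsilon> by simp
    qed
    have 2: "cmod am \<le> Z2 * \<epsilon>"
    proof -
      have "cmod am \<le> Z2 * \<bar>(\<alpha> - \<epsilon>) - \<alpha>\<bar>"
        unfolding am_def using \<alpha> \<epsilon>
        by (intro vector_derivative_imp_Lipschitz[of "l-1" "u+1" z' z'']) (auto intro: z'' Z2)
      then show ?thesis using \<epsilon> by simp
    qed
    \<comment> \<open>Up to sign, the sum of the two chords is the second difference of the curve.\<close>
    have 3: "cmod (dp + dm) \<le> 2 * Z2 * \<epsilon>\<^sup>2"
    proof -
      have "cmod (z (\<alpha> + \<epsilon>) + z (\<alpha> - \<epsilon>) - 2 *\<^sub>R z \<alpha>) \<le> 2 * Z2 * \<epsilon>\<^sup>2"
        using \<alpha> \<epsilon> by (intro second_difference_bound[of \<alpha> \<epsilon> z z' z'']) (auto intro!: z' z'' Z2)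
      then show ?thesis
        unfolding dp_def dm_def
        by (subst norm_minus_cancel[symmetric]) (simp add: scaleR_2 algebra_simps)
    qed
    have 4: "cmod (ap + am) \<le> 2 * Z3 * \<epsilon>\<^sup>2"
    proof -
      have "cmod (z' (\<alpha> + \<epsilon>) + z' (\<alpha> - \<epsilon>) - 2 *\<^sub>R z' \<alpha>) \<le> 2 * Z3 * \<epsilon>\<^sup>2"
        using \<alpha> \<epsilon> by (intro second_difference_bound[of \<alpha> \<epsilon> z' z'' z''']) (auto intro!: z'' z''' Z3)
      then show ?thesis
        unfolding ap_def am_def by (simp add: scaleR_2 algebra_simps)
    qed
    have 5: "cmod dm \<le> M * \<epsilon>" "cmod dp \<le> M * \<epsilon>"
    proof -
      have "cmod dm \<le> M * \<bar>\<alpha> - (\<alpha> - \<epsilon>)\<bar>"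
        unfolding dm_def using \<alpha> \<epsilon>
        by (intro vector_derivative_imp_Lipschitz[of "l-1" "u+1" z z']) (auto intro: z' z'_bounded)
      then show "cmod dm \<le> M * \<epsilon>" using \<epsilon> by simp
      have "cmod dp \<le> M * \<bar>\<alpha> - (\<alpha> + \<epsilon>)\<bar>"
        unfolding dp_def using \<alpha> \<epsilon>
        by (intro vector_derivative_imp_Lipschitz[of "l-1" "u+1" z z']) (auto intro: z' z'_bounded)
      then show "cmod dp \<le> M * \<epsilon>" using \<epsilon> by simp
    qed
    have 6: "cmod (f (\<alpha> + \<epsilon>)) \<le> K0"
      using \<alpha> \<epsilon> by (intro K0) auto
    have "f (\<alpha> - \<epsilon>) * am / dm - f (\<alpha> + \<epsilon>) * ap / dp =
        ((f (\<alpha> - \<epsilon>) - f (\<alpha> + \<epsilon>)) * am * dp + f (\<alpha> + \<epsilon>) * (am * (dp + dm) - (ap + am) * dm)) / (dm * dp)"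
      using nz by (simp add: field_simps)
    also have "cmod \<dots> \<le> (?K * \<epsilon>^3) / (c\<^sup>2 * \<epsilon>\<^sup>2)"
      unfolding norm_divide
    proof (rule frac_le)
      have "cmod ((f (\<alpha> - \<epsilon>) - f (\<alpha> + \<epsilon>)) * am * dp + f (\<alpha> + \<epsilon>) * (am * (dp + dm) - (ap + am) * dm))
        \<le> cmod (f (\<alpha> - \<epsilon>) - f (\<alpha> + \<epsilon>)) * cmod am * cmod dp
          + cmod (f (\<alpha> + \<epsilon>)) * (cmod am * cmod (dp + dm) + cmod (ap + am) * cmod dm)"
        using norm_triangle_ineq[of "(f (\<alpha> - \<epsilon>) - f (\<alpha> + \<epsilon>)) * am * dp" "f (\<alpha> + \<epsilon>) * (am * (dp + dm) - (ap + am) * dm)"]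
          mult_left_mono[OF norm_triangle_ineq4[of "am * (dp + dm)" "(ap + am) * dm"] norm_ge_zero[of "f (\<alpha> + \<epsilon>)"]]
        unfolding norm_mult by linarith
      also have "\<dots> \<le> (2 * K1 * \<epsilon>) * (Z2 * \<epsilon>) * (M * \<epsilon>)
          + K0 * ((Z2 * \<epsilon>) * (2 * Z2 * \<epsilon>\<^sup>2) + (2 * Z3 * \<epsilon>\<^sup>2) * (M * \<epsilon>))"
        using 1 2 3 4 5 6 \<epsilon> K0 K1 Z2 Z3 M by (intro add_mono mult_mono) auto
      finally show "cmod ((f (\<alpha> - \<epsilon>) - f (\<alpha> + \<epsilon>)) * am * dp + f (\<alpha> + \<epsilon>) * (am * (dp + dm) - (ap + am) * dm))
        \<le> ?K * \<epsilon>^3"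
        by (simp add: algebra_simps power2_eq_square power3_eq_cube)
      have "(c * \<epsilon>) * (c * \<epsilon>) \<le> cmod dm * cmod dp"
        unfolding dm_def dp_def
        using chord_arc[of \<alpha> "\<alpha> + \<epsilon>"] chord_arc[of \<alpha> "\<alpha> - \<epsilon>"] c_pos \<epsilon> by (intro mult_mono) auto
      then show "c\<^sup>2 * \<epsilon>\<^sup>2 \<le> cmod (dm * dp)"
        by (simp add: power2_eq_square norm_mult algebra_simps)
      show "0 < c\<^sup>2 * \<epsilon>\<^sup>2" using c_pos \<epsilon> by auto
      show "0 \<le> ?K * \<epsilon>^3" using K0 K1 M Z2 Z3 \<epsilon> by auto
    qed
    also have "\<dots> = ?K / c\<^sup>2 * \<epsilon>"
      using \<epsilon> by (simp add: power2_eq_square power3_eq_cube)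
    finally show "cmod (f (\<alpha> - \<epsilon>) * (z' (\<alpha> - \<epsilon>) - z' \<alpha>) / (z \<alpha> - z (\<alpha> - \<epsilon>))
       - f (\<alpha> + \<epsilon>) * (z' (\<alpha> + \<epsilon>) - z' \<alpha>) / (z \<alpha> - z (\<alpha> + \<epsilon>))) \<le> ?K / c\<^sup>2 * \<epsilon>" 
      unfolding dp_def dm_def ap_def am_def .
  qed
qed

text \<open>In terms of the Hilbert transform this is \<open>\<partial>\<^sub>\<alpha> (H f) = z' H (f' / z')\<close>. Integration by parts moves the derivative of the
  kernel onto \<open>f\<close>; the truncated identities have boundary errors \<open>O(\<epsilon>)\<close> and their derivatives converge uniformly on
  compact sets, so the derivative passes to the limit.\<close>

theorem Cauchy_pv_has_vector_derivative:
  assumes f: "square_integrable f" "\<And>x. (f has_vector_derivative f' x) (at x)"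
    and f': "square_integrable f'" "\<And>x. (f' has_vector_derivative f'' x) (at x)"
      "continuous_on UNIV f''"
  shows "((\<lambda>\<alpha>. pv_integral (\<lambda>\<beta>. f \<beta> * z' \<beta> / (z \<alpha> - z \<beta>)) \<alpha>) has_vector_derivative
      z' \<alpha>0 * pv_integral (\<lambda>\<beta>. f' \<beta> / (z \<alpha>0 - z \<beta>)) \<alpha>0) (at \<alpha>0)"
proof -
  have cf: "continuous_on UNIV f" "continuous_on UNIV f'"
    using f f' by (auto intro!: continuous_at_imp_continuous_on has_vector_derivative_continuous)
  let ?S = "{\<alpha>0-1..\<alpha>0+1}"
  let ?F = "\<lambda>\<alpha>. pv_integral (\<lambda>\<beta>. f \<beta> * z' \<beta> / (z \<alpha> - z \<beta>)) \<alpha>"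
  let ?G = "\<lambda>\<alpha>. pv_integral (\<lambda>\<beta>. f' \<beta> / (z \<alpha> - z \<beta>)) \<alpha>"
  let ?\<phi> = "\<lambda>\<beta>. f \<beta> * z' \<beta>"
  define B where "B \<epsilon> \<alpha> = f (\<alpha> - \<epsilon>) * (z' (\<alpha> - \<epsilon>) - z' \<alpha>) / (z \<alpha> - z (\<alpha> - \<epsilon>))
       - f (\<alpha> + \<epsilon>) * (z' (\<alpha> + \<epsilon>) - z' \<alpha>) / (z \<alpha> - z (\<alpha> + \<epsilon>))" for \<epsilon> \<alpha>
  have \<phi>: "square_integrable ?\<phi>" "continuous_on UNIV ?\<phi>"
    "\<And>x. (?\<phi> has_vector_derivative f x * z'' x + f' x * z' x) (at x)"
    "continuous_on UNIV (\<lambda>x. f x * z'' x + f' x * z' x)"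
    using cf z_continuous f(2) z'' 
    by (auto intro!: square_integrable_mult_z' f continuous_intros has_vector_derivative_mult)
  have deriv: "(truncated_Cauchy ?\<phi> \<epsilon> has_vector_derivative z' \<alpha> * truncated_Cauchy f' \<epsilon> \<alpha> + B \<epsilon> \<alpha>) (at \<alpha>)"
    if "0 < \<epsilon>" for \<epsilon> \<alpha>
  proof -
    let ?I = "LBINT \<beta>:{\<beta>. \<epsilon> \<le> \<bar>\<beta> - \<alpha>\<bar>}. ?\<phi> \<beta> / (z \<alpha> - z \<beta>)\<^sup>2"
    have "(truncated_Cauchy ?\<phi> \<epsilon> has_vector_derivative
       ?\<phi> (\<alpha> - \<epsilon>) / (z \<alpha> - z (\<alpha> - \<epsilon>)) - ?\<phi> (\<alpha> + \<epsilon>) / (z \<alpha> - z (\<alpha> + \<epsilon>)) - z' \<alpha> * ?I) (at \<alpha>)"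
      by (rule truncated_has_vector_derivative[OF \<phi>(1,2) that])
    also have "?I = f (\<alpha> - \<epsilon>) / (z \<alpha> - z (\<alpha> - \<epsilon>)) - f (\<alpha> + \<epsilon>) / (z \<alpha> - z (\<alpha> + \<epsilon>)) - truncated_Cauchy f' \<epsilon> \<alpha>"
      using truncated_by_parts[OF f cf(2) f'(1) that, of \<alpha>] by (simp add: algebra_simps)
    also have "?\<phi> (\<alpha> - \<epsilon>) / (z \<alpha> - z (\<alpha> - \<epsilon>)) - ?\<phi> (\<alpha> + \<epsilon>) / (z \<alpha> - z (\<alpha> + \<epsilon>)) - z' \<alpha> * \<dots>
       = z' \<alpha> * truncated_Cauchy f' \<epsilon> \<alpha> + B \<epsilon> \<alpha>"
      by (simp add: B_def algebra_simps diff_divide_distrib)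
    finally show ?thesis .
  qed
  obtain C1 where C1: "0 < C1" "\<And>\<alpha> p. \<alpha> \<in> ?S \<Longrightarrow> p \<in> {0<..1} \<Longrightarrow> cmod (truncated_Cauchy f' p \<alpha> - ?G \<alpha>) \<le> C1 * p"
    by (rule truncated_tendsto_pv[OF f', of "\<alpha>0-1" "\<alpha>0+1"]) (rule that)
  obtain C2 where C2: "0 < C2" "\<And>\<alpha> \<epsilon>. \<alpha> \<in> ?S \<Longrightarrow> \<epsilon> \<in> {0<..1} \<Longrightarrow> cmod (B \<epsilon> \<alpha>) \<le> C2 * \<epsilon>"
    by (rule boundary_terms_cancel[OF f(2) cf(2), of "\<alpha>0-1" "\<alpha>0+1"]) (rule that, assumption, simp only: B_def)
  have C3: "((\<lambda>p. truncated_Cauchy ?\<phi> p \<alpha>) \<longlongrightarrow> ?F \<alpha>) (at_right 0)" if "\<alpha> \<in> ?S" for \<alpha>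
    by (rule truncated_tendsto_pv[OF \<phi>(1,3,4), of "\<alpha>0-1" "\<alpha>0+1"]) (use that in blast)
  define q where "q n = inverse (real (Suc n))" for n
  have q: "q n \<in> {0<..1}" for n
    by (auto simp: q_def field_simps)
  have q0: "q \<longlonglongrightarrow> 0"
    unfolding q_def by (rule LIMSEQ_inverse_real_of_nat)
  then have q_right: "filterlim q (at_right 0) sequentially"
    using q by (auto simp: filterlim_at less_le intro!: always_eventually)
  have lim: "(\<lambda>n. truncated_Cauchy ?\<phi> (q n) \<alpha>) \<longlonglongrightarrow> ?F \<alpha>" if "\<alpha> \<in> ?S" for \<alpha>
    using filterlim_compose[OF C3[OF that] q_right] .
  have "\<exists>g. \<forall>x\<in>?S. (\<lambda>n. truncated_Cauchy ?\<phi> (q n) x) \<longlonglongrightarrow> g x \<and> (g has_derivative (\<lambda>h. h *\<^sub>R (z' x * ?G x))) (at x within ?S)"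
  proof (rule has_derivative_sequence)
    show "convex ?S" by (rule convex_real_interval)
    show "\<alpha>0 \<in> ?S" by simp
    show "(\<lambda>n. truncated_Cauchy ?\<phi> (q n) \<alpha>0) \<longlonglongrightarrow> ?F \<alpha>0" by (rule lim) simp
    show "(truncated_Cauchy ?\<phi> (q n) has_derivative (\<lambda>h. h *\<^sub>R (z' x * truncated_Cauchy f' (q n) x + B (q n) x))) (at x within ?S)" for n x
      using deriv[of "q n" x] q[of n] unfolding has_vector_derivative_def
      by (auto intro: has_derivative_at_withinI)
    fix e :: real assume "0 < e"
    have "(\<lambda>n. (M * C1 + C2) * q n) \<longlonglongrightarrow> (M * C1 + C2) * 0"
      by (intro tendsto_intros q0)
    then have "eventually (\<lambda>n. (M * C1 + C2) * q n < e) sequentially"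
      using \<open>0 < e\<close> by (auto dest: order_tendstoD(2))
    then show "\<forall>\<^sub>F n in sequentially. \<forall>x\<in>?S. \<forall>h. norm (h *\<^sub>R (z' x * truncated_Cauchy f' (q n) x + B (q n) x)
        - h *\<^sub>R (z' x * ?G x)) \<le> e * norm h"
    proof eventually_elim
      case (elim n)
      show ?case
      proof (intro ballI allI)
        fix x h assume x: "x \<in> ?S"
        have "cmod (z' x * truncated_Cauchy f' (q n) x + B (q n) x - z' x * ?G x)
            = cmod (z' x * (truncated_Cauchy f' (q n) x - ?G x) + B (q n) x)"
          by (simp add: algebra_simps)
        also have "\<dots> \<le> cmod (z' x) * cmod (truncated_Cauchy f' (q n) x - ?G x) + cmod (B (q n) x)"
          by (metis norm_mult norm_triangle_ineq)
        also have "\<dots> \<le> M * (C1 * q n) + C2 * q n"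
          using C1(2)[OF x q] C2(2)[OF x q] z'_bounded[of x] order_trans[OF norm_ge_zero z'_bounded]
          by (intro add_mono mult_mono) auto
        also have "\<dots> \<le> e"
          using elim by (simp add: algebra_simps)
        finally have "cmod (z' x * truncated_Cauchy f' (q n) x + B (q n) x - z' x * ?G x) * \<bar>h\<bar> \<le> e * \<bar>h\<bar>"
          by (intro mult_right_mono) auto
        then show "norm (h *\<^sub>R (z' x * truncated_Cauchy f' (q n) x + B (q n) x)
          - h *\<^sub>R (z' x * ?G x)) \<le> e * norm h"
          by (simp add: scaleR_diff_right[symmetric] mult.commute)
      qed
    qed
  qed
  then obtain g where g: "\<And>x. x \<in> ?S \<Longrightarrow> (\<lambda>n. truncated_Cauchy ?\<phi> (q n) x) \<longlonglongrightarrow> g x"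
      "\<And>x. x \<in> ?S \<Longrightarrow> (g has_derivative (\<lambda>h. h *\<^sub>R (z' x * ?G x))) (at x within ?S)"
    by blast
  have "g x = ?F x" if "x \<in> ?S" for x
    using LIMSEQ_unique[OF g(1)[OF that] lim[OF that]] .
  then have "(?F has_derivative (\<lambda>h. h *\<^sub>R (z' \<alpha>0 * ?G \<alpha>0))) (at \<alpha>0 within ?S)"
    using has_derivative_transform[OF _ _ g(2)] by auto
  moreover have "at \<alpha>0 within ?S = at \<alpha>0"
    by (rule at_within_interior) simp
  ultimately show ?thesis
    unfolding has_vector_derivative_def by simp
qed


section \<open>Division by the tangent and linearity\<close>

lemma z'_lower_bound: "c \<le> cmod (z' \<alpha>)"
proof (rule tendsto_lowerbound)
  show "((\<lambda>x. cmod ((z x - z \<alpha>) /\<^sub>R (x - \<alpha>))) \<longlongrightarrow> cmod (z' \<alpha>)) (at \<alpha>)"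
    using z'[of \<alpha>] unfolding has_vector_derivative_iff_slope by (rule tendsto_norm)
  have "c \<le> cmod ((z x - z \<alpha>) /\<^sub>R (x - \<alpha>))" if "x \<noteq> \<alpha>" for x
  proof -
    have "cmod ((z x - z \<alpha>) /\<^sub>R (x - \<alpha>)) = cmod (z x - z \<alpha>) / \<bar>x - \<alpha>\<bar>"
      by (simp only: norm_scaleR) (simp add: divide_inverse mult.commute)
    then show ?thesis
      using chord_arc[of x \<alpha>] that by (simp add: pos_le_divide_eq)
  qed
  then show "\<forall>\<^sub>F x in at \<alpha>. c \<le> cmod ((z x - z \<alpha>) /\<^sub>R (x - \<alpha>))"
    by (auto simp: eventually_at_filter)
qed simp

lemma z'_nonzero: "z' \<alpha> \<noteq> 0"
  using z'_lower_bound[of \<alpha>] c_pos by auto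

lemma square_integrable_divide_z':
  assumes "square_integrable f"
  shows "square_integrable (\<lambda>\<beta>. f \<beta> / z' \<beta>)"
  unfolding square_integrable_def
proof
  have [measurable]: "f \<in> borel_measurable borel"
    using assms by (simp add: square_integrable_def)
  show "(\<lambda>\<beta>. f \<beta> / z' \<beta>) \<in> borel_measurable lborel"
    by measurable
  have "integrable lborel (\<lambda>x. (cmod (f x))\<^sup>2 / c\<^sup>2)"
    using assms by (simp add: square_integrable_def)
  then show "integrable lborel (\<lambda>x. (cmod (f x / z' x))\<^sup>2)"
  proof (rule Bochner_Integration.integrable_bound)
    have "(cmod (f x / z' x))\<^sup>2 \<le> (cmod (f x))\<^sup>2 / c\<^sup>2" for x
      unfolding norm_divide power_divide
      using power_mono[OF z'_lower_bound[of x], of 2] c_pos by (intro divide_left_mono) (auto simp: z'_nonzero)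
    then show "AE x in lborel. norm ((cmod (f x / z' x))\<^sup>2) \<le> norm ((cmod (f x))\<^sup>2 / c\<^sup>2)"
      by auto
  qed measurable
qed

text \<open>Linearity over the complex numbers has to be proved through the truncations, because \<open>pv_integral\<close> is a limit
  whose existence depends on the density; the real and imaginary parts inherit the regularity of \<open>w\<close>.\<close>

lemma Cauchy_pv_cnj:
  assumes w: "square_integrable w" "\<And>x. (w has_vector_derivative w' x) (at x)" "continuous_on UNIV w'"
  shows "pv_integral (\<lambda>\<beta>. cnj (w \<beta>) * z' \<beta> / (z \<alpha> - z \<beta>)) \<alpha> =
    pv_integral (\<lambda>\<beta>. of_real (Re (w \<beta>)) * z' \<beta> / (z \<alpha> - z \<beta>)) \<alpha>
      - \<i> * pv_integral (\<lambda>\<beta>. of_real (Im (w \<beta>)) * z' \<beta> / (z \<alpha> - z \<beta>)) \<alpha>"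
proof -
  have cw: "continuous_on UNIV w"
    using w by (auto intro!: continuous_at_imp_continuous_on has_vector_derivative_continuous)
  have wz: "square_integrable (\<lambda>\<beta>. complex_of_real (p (w \<beta>)) * z' \<beta>) \<and>
      (\<forall>\<alpha>. ((\<lambda>\<epsilon>. truncated_Cauchy (\<lambda>\<beta>. complex_of_real (p (w \<beta>)) * z' \<beta>) \<epsilon> \<alpha>) \<longlongrightarrow>
        pv_integral (\<lambda>\<beta>. of_real (p (w \<beta>)) * z' \<beta> / (z \<alpha> - z \<beta>)) \<alpha>) (at_right 0))"
    if p: "bounded_linear p" "\<And>v. \<bar>p v\<bar> \<le> cmod v" for p :: "complex \<Rightarrow> real"
  proof -
    have cp: "continuous_on UNIV (\<lambda>\<beta>. p (w \<beta>))" "continuous_on UNIV (\<lambda>\<beta>. p (w' \<beta>))"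
      using cw w(3) by (auto intro: bounded_linear.continuous_on[OF p(1)])
    have "square_integrable (\<lambda>\<beta>. complex_of_real (p (w \<beta>)))"
      unfolding square_integrable_def
    proof
      show "(\<lambda>\<beta>. complex_of_real (p (w \<beta>))) \<in> borel_measurable lborel"
        using cp by (auto intro!: borel_measurable_continuous_onI continuous_intros)
      have "integrable lborel (\<lambda>x. (cmod (w x))\<^sup>2)"
        using w(1) by (simp add: square_integrable_def)
      then show "integrable lborel (\<lambda>x. (cmod (complex_of_real (p (w x))))\<^sup>2)"
      proof (rule Bochner_Integration.integrable_bound)
        show "(\<lambda>x. (cmod (complex_of_real (p (w x))))\<^sup>2) \<in> borel_measurable lborel"
          using cp by (auto intro!: borel_measurable_continuous_onI continuous_intros)
      qed (use power_mono[OF p(2) abs_ge_zero, of _ 2] in simp)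
    qed
    then have sq: "square_integrable (\<lambda>\<beta>. complex_of_real (p (w \<beta>)) * z' \<beta>)"
      by (rule square_integrable_mult_z')
    have "((\<lambda>\<beta>. complex_of_real (p (w \<beta>))) has_vector_derivative of_real (p (w' x))) (at x)" for x
      using bounded_linear.has_vector_derivative[OF p(1) w(2)]
      by (intro has_vector_derivative_of_real) (simp add: has_real_derivative_iff_has_vector_derivative)
    then have d: "((\<lambda>\<beta>. complex_of_real (p (w \<beta>)) * z' \<beta>) has_vector_derivative
        of_real (p (w x)) * z'' x + of_real (p (w' x)) * z' x) (at x)" for x
      using z'' by (intro has_vector_derivative_mult) auto
    have cd: "continuous_on UNIV (\<lambda>x. of_real (p (w x)) * z'' x + of_real (p (w' x)) * z' x)"
      using cp z_continuous by (intro continuous_intros)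
    have "((\<lambda>\<epsilon>. truncated_Cauchy (\<lambda>\<beta>. complex_of_real (p (w \<beta>)) * z' \<beta>) \<epsilon> \<alpha>) \<longlongrightarrow>
        pv_integral (\<lambda>\<beta>. of_real (p (w \<beta>)) * z' \<beta> / (z \<alpha> - z \<beta>)) \<alpha>) (at_right 0)" for \<alpha>
      by (rule truncated_tendsto_pv[OF sq d cd, of \<alpha> \<alpha>]) simp
    with sq show ?thesis by blast
  qed
  let ?R = "\<lambda>\<beta>. complex_of_real (Re (w \<beta>)) * z' \<beta>" and ?I = "\<lambda>\<beta>. complex_of_real (Im (w \<beta>)) * z' \<beta>"
  note R = wz[OF bounded_linear_Re abs_Re_le_cmod]
  note I = wz[OF bounded_linear_Im abs_Im_le_cmod]
  have "truncated_Cauchy (\<lambda>\<beta>. cnj (w \<beta>) * z' \<beta>) \<epsilon> \<alpha> = truncated_Cauchy ?R \<epsilon> \<alpha> - \<i> * truncated_Cauchy ?I \<epsilon> \<alpha>" if "0 < \<epsilon>" for \<epsilon>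
  proof -
    have "cnj (w \<beta>) * z' \<beta> / (z \<alpha> - z \<beta>) = ?R \<beta> / (z \<alpha> - z \<beta>) - \<i> * (?I \<beta> / (z \<alpha> - z \<beta>))" for \<beta>
    proof -
      have "cnj (w \<beta>) = of_real (Re (w \<beta>)) - \<i> * of_real (Im (w \<beta>))"
        by (simp add: complex_eq_iff)
      then show ?thesis
        by (simp only: left_diff_distrib diff_divide_distrib mult.assoc times_divide_eq_right)
    qed
    moreover have "set_integrable lborel {\<beta>. \<epsilon> \<le> \<bar>\<beta> - \<alpha>\<bar>} (\<lambda>\<beta>. ?R \<beta> / (z \<alpha> - z \<beta>))"
      "set_integrable lborel {\<beta>. \<epsilon> \<le> \<bar>\<beta> - \<alpha>\<bar>} (\<lambda>\<beta>. \<i> * (?I \<beta> / (z \<alpha> - z \<beta>)))"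
      using R I that by (auto intro!: set_integrable_mult_right set_integrable_Cauchy_kernel
        simp del: times_divide_eq_right)
    ultimately show ?thesis
      unfolding truncated_Cauchy_def by (simp only: set_integral_diff(2) set_integral_mult_right)
  qed
  then have "\<forall>\<^sub>F \<epsilon> in at_right 0. truncated_Cauchy ?R \<epsilon> \<alpha> - \<i> * truncated_Cauchy ?I \<epsilon> \<alpha> = truncated_Cauchy (\<lambda>\<beta>. cnj (w \<beta>) * z' \<beta>) \<epsilon> \<alpha>"
    by (auto simp: eventually_at_filter)
  moreover have "((\<lambda>\<epsilon>. truncated_Cauchy ?R \<epsilon> \<alpha> - \<i> * truncated_Cauchy ?I \<epsilon> \<alpha>) \<longlongrightarrow>
     pv_integral (\<lambda>\<beta>. ?R \<beta> / (z \<alpha> - z \<beta>)) \<alpha> - \<i> * pv_integral (\<lambda>\<beta>. ?I \<beta> / (z \<alpha> - z \<beta>)) \<alpha>) (at_right 0)"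
    using R I by (intro tendsto_intros) auto
  ultimately have "((\<lambda>\<epsilon>. truncated_Cauchy (\<lambda>\<beta>. cnj (w \<beta>) * z' \<beta>) \<epsilon> \<alpha>) \<longlongrightarrow>
     pv_integral (\<lambda>\<beta>. ?R \<beta> / (z \<alpha> - z \<beta>)) \<alpha> - \<i> * pv_integral (\<lambda>\<beta>. ?I \<beta> / (z \<alpha> - z \<beta>)) \<alpha>) (at_right 0)"
    by (rule Lim_transform_eventually[rotated])
  then show ?thesis
    unfolding pv_integral_def[of "\<lambda>\<beta>. cnj (w \<beta>) * z' \<beta> / (z \<alpha> - z \<beta>)"] truncated_Cauchy_def by (intro tendsto_Lim) auto
qed

end

section \<open>Partial derivatives\<close>

lemma Ck_on_D\<^sub>\<alpha>: "Ck_on (Suc k) T f \<Longrightarrow> Ck_on k T (D\<^sub>\<alpha> f)"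
  and Ck_on_D\<^sub>t: "Ck_on (Suc k) T f \<Longrightarrow> Ck_on k T (D\<^sub>t f)"
  by auto

lemma Ck_on_Suc_imp: "Ck_on (Suc k) T f \<Longrightarrow> Ck_on k T f"
proof (induction k arbitrary: f)
  case (Suc k)
  have "Ck_on k T (D\<^sub>\<alpha> f)" "Ck_on k T (D\<^sub>t f)"
    using Suc.IH[OF Ck_on_D\<^sub>\<alpha>[OF Suc.prems]] Suc.IH[OF Ck_on_D\<^sub>t[OF Suc.prems]] .
  then show ?case
    using Suc.prems unfolding Ck_on.simps(2)[of k] Ck_on.simps(2)[of "Suc k"] by blast
qed simp

lemma Ck_on_antimono: "Ck_on m T f \<Longrightarrow> k \<le> m \<Longrightarrow> Ck_on k T f"
  by (induction m) (auto simp: le_Suc_eq simp del: Ck_on.simps dest: Ck_on_Suc_imp)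

lemma Ck_on_imp_continuous: "Ck_on k T f \<Longrightarrow> continuous_on (UNIV \<times> T) (\<lambda>(\<alpha>, t). f \<alpha> t)"
  using Ck_on_antimono[of k T f 0] by simp

lemma Ck_on_imp_continuous_space:
  assumes "Ck_on k T f" "t \<in> T"
  shows "continuous_on UNIV (\<lambda>\<alpha>. f \<alpha> t)"
proof -
  have "continuous_on UNIV (\<lambda>\<alpha>. (\<lambda>(\<alpha>, t). f \<alpha> t) (\<alpha>, t))"
    by (rule continuous_on_compose2[OF Ck_on_imp_continuous[OF assms(1)]])
      (use assms(2) in \<open>auto intro!: continuous_intros\<close>)
  then show ?thesis by simp
qed

lemma Ck_on_has_vector_derivative:
  assumes "Ck_on k T f" "t \<in> T" "0 < k"
  shows "((\<lambda>x. f x t) has_vector_derivative D\<^sub>\<alpha> f \<alpha> t) (at \<alpha>)"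
    and "((\<lambda>\<tau>. f \<alpha> \<tau>) has_vector_derivative D\<^sub>t f \<alpha> t) (at t)"
  using Ck_on_antimono[OF assms(1), of 1] assms(2,3)
  by (simp_all add: D\<^sub>\<alpha>_def D\<^sub>t_def vector_derivative_works[symmetric])

text \<open>Differentiate \<open>f \<alpha> t = f a t + \<integral>\<^sub>a\<^sup>\<alpha> D\<^sub>\<alpha> f\<close> in time under the integral sign, and then in
  space by the fundamental theorem of calculus.\<close>

lemma D_commute:
  fixes f :: "real \<Rightarrow> real \<Rightarrow> 'a::banach"
  assumes f: "Ck_on k T f" "2 \<le> k" and T: "open T" "t \<in> T"
  shows "D\<^sub>\<alpha> (D\<^sub>t f) \<alpha> t = D\<^sub>t (D\<^sub>\<alpha> f) \<alpha> t"
proof -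
  have C2: "Ck_on 2 T f"
    using Ck_on_antimono[OF f] .
  then have Ca: "Ck_on 1 T (D\<^sub>\<alpha> f)" and Ct: "Ck_on 1 T (D\<^sub>t f)"
    by (auto simp: numeral_2_eq_2)
  obtain r where r: "r > 0" "cball t r \<subseteq> T"
    using T open_contains_cball by blast
  define U where "U = cball t r"
  have U: "convex U" "U \<subseteq> T" "t \<in> U" "t \<in> interior U"
    using r by (auto simp: U_def)
  define a where "a = \<alpha> - 1"
  have FTC: "((\<lambda>\<xi>. D\<^sub>\<alpha> f \<xi> \<tau>) has_integral f x \<tau> - f a \<tau>) {a..x}" if "\<tau> \<in> U" "a \<le> x" for x \<tau>
    using that U Ck_on_has_vector_derivative(1)[OF C2, of \<tau>]
    by (intro fundamental_theorem_of_calculus) (auto intro: has_vector_derivative_at_within)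
  have cont: "continuous_on (UNIV \<times> T) (\<lambda>(\<xi>, \<tau>). D\<^sub>t (D\<^sub>\<alpha> f) \<xi> \<tau>)"
    using Ca by simp
  have t_deriv: "D\<^sub>t f x t = D\<^sub>t f a t + integral {a..x} (\<lambda>\<xi>. D\<^sub>t (D\<^sub>\<alpha> f) \<xi> t)" if "a \<le> x" for x
  proof -
    have "((\<lambda>\<tau>. integral (cbox a x) (\<lambda>\<xi>. D\<^sub>\<alpha> f \<xi> \<tau>)) has_vector_derivative
        integral (cbox a x) (\<lambda>\<xi>. D\<^sub>t (D\<^sub>\<alpha> f) \<xi> t)) (at t within U)"
    proof (rule leibniz_rule_vector_derivative)
      show "((\<lambda>\<tau>. D\<^sub>\<alpha> f \<xi> \<tau>) has_vector_derivative D\<^sub>t (D\<^sub>\<alpha> f) \<xi> \<tau>) (at \<tau> within U)" if "\<tau> \<in> U" for \<tau> \<xi>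
        using that U Ck_on_has_vector_derivative(2)[OF Ca, of \<tau>]
        by (auto intro: has_vector_derivative_at_within)
      show "(\<lambda>\<xi>. D\<^sub>\<alpha> f \<xi> \<tau>) integrable_on cbox a x" if "\<tau> \<in> U" for \<tau>
        using FTC[OF that \<open>a \<le> x\<close>] by auto
      show "continuous_on (U \<times> cbox a x) (\<lambda>(\<tau>, \<xi>). D\<^sub>t (D\<^sub>\<alpha> f) \<xi> \<tau>)"
      proof -
        have "continuous_on (U \<times> cbox a x) (\<lambda>p. (\<lambda>(\<xi>, \<tau>). D\<^sub>t (D\<^sub>\<alpha> f) \<xi> \<tau>) (snd p, fst p))"
          by (rule continuous_on_compose2[OF cont]) (use U in \<open>auto intro!: continuous_intros\<close>)
        then show ?thesis
          by (simp add: case_prod_unfold)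
      qed
    qed (use U in auto)
    then have "((\<lambda>\<tau>. f x \<tau> - f a \<tau>) has_vector_derivative
        integral (cbox a x) (\<lambda>\<xi>. D\<^sub>t (D\<^sub>\<alpha> f) \<xi> t)) (at t within U)"
      by (rule has_vector_derivative_transform[rotated 2])
        (use U integral_unique[OF FTC[OF _ that]] in auto)
    then have "((\<lambda>\<tau>. f x \<tau> - f a \<tau>) has_vector_derivative
        integral {a..x} (\<lambda>\<xi>. D\<^sub>t (D\<^sub>\<alpha> f) \<xi> t)) (at t)"
      using at_within_interior[OF U(4)] by simp
    moreover have "((\<lambda>\<tau>. f x \<tau> - f a \<tau>) has_vector_derivative D\<^sub>t f x t - D\<^sub>t f a t) (at t)"
      using Ck_on_has_vector_derivative(2)[OF C2 T(2)] by (intro has_vector_derivative_diff) auto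
    ultimately show ?thesis
      using vector_derivative_unique_at by (metis add_diff_cancel_left' add_diff_eq diff_add_cancel add.commute)
  qed
  have "((\<lambda>x. integral {a..x} (\<lambda>\<xi>. D\<^sub>t (D\<^sub>\<alpha> f) \<xi> t)) has_vector_derivative D\<^sub>t (D\<^sub>\<alpha> f) \<alpha> t) (at \<alpha> within {a..\<alpha>+1})"
    using Ck_on_imp_continuous_space[of 0 T "D\<^sub>t (D\<^sub>\<alpha> f)" t] Ca T(2)
    by (intro integral_has_vector_derivative) (auto simp: a_def intro: continuous_on_subset)
  then have "((\<lambda>x. integral {a..x} (\<lambda>\<xi>. D\<^sub>t (D\<^sub>\<alpha> f) \<xi> t)) has_vector_derivative D\<^sub>t (D\<^sub>\<alpha> f) \<alpha> t) (at \<alpha>)"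
    using at_within_interior[of \<alpha> "{a..\<alpha>+1}"] by (simp add: a_def)
  then have "((\<lambda>x. D\<^sub>t f a t + integral {a..x} (\<lambda>\<xi>. D\<^sub>t (D\<^sub>\<alpha> f) \<xi> t)) has_vector_derivative D\<^sub>t (D\<^sub>\<alpha> f) \<alpha> t) (at \<alpha>)"
    by (auto intro!: derivative_eq_intros)
  then have "((\<lambda>x. D\<^sub>t f x t) has_vector_derivative D\<^sub>t (D\<^sub>\<alpha> f) \<alpha> t) (at \<alpha>)"
    by (rule has_vector_derivative_transform_within_open[where S = "{a<..}"])
      (auto simp: a_def intro: t_deriv[symmetric, unfolded a_def])
  then show ?thesis
    by (simp add: D\<^sub>\<alpha>_def vector_derivative_at)
qed

section \<open>Kinematics of the interface\<close>

text \<open>The chain rule for \<open>D\<^sub>t \<kappa>\<close> composed with the inverse of \<open>\<kappa>\<close>.\<close>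

lemma u_lagr_eq:
  assumes \<kappa>: "Ck_on 2 T \<kappa>" and t: "t \<in> T" and bij: "bij (\<lambda>\<alpha>. \<kappa> \<alpha> t)"
    and pos: "\<And>\<alpha>. D\<^sub>\<alpha> \<kappa> \<alpha> t > 0"
  shows "u_lagr \<kappa> \<alpha> t = D\<^sub>\<alpha> (D\<^sub>t \<kappa>) \<alpha> t / D\<^sub>\<alpha> \<kappa> \<alpha> t"
proof -
  let ?K = "\<lambda>\<alpha>. \<kappa> \<alpha> t"
  have K: "(?K has_real_derivative D\<^sub>\<alpha> \<kappa> x t) (at x)" for x
    using Ck_on_has_vector_derivative(1)[OF \<kappa> t] by (simp add: has_real_derivative_iff_has_vector_derivative)
  have Kinv: "?K (inv ?K s) = s" "inv ?K (?K x) = x" for s x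
    using bij surj_f_inv_f[OF bij_is_surj[OF bij]] inv_f_f[OF bij_is_inj[OF bij]] by auto
  have "isCont (inv ?K) (?K \<alpha>)"
    by (rule isCont_inverse_function[where d = 1 and f = ?K]) (use Kinv K in \<open>auto intro: DERIV_isCont\<close>)
  then have inv: "(inv ?K has_real_derivative inverse (D\<^sub>\<alpha> \<kappa> \<alpha> t)) (at (?K \<alpha>))"
    using K[of \<alpha>] Kinv pos[of \<alpha>]
    by (intro DERIV_inverse_function[where a = "?K \<alpha> - 1" and b = "?K \<alpha> + 1" and f = ?K]) auto
  have C1: "Ck_on 1 T (D\<^sub>t \<kappa>)"
    using \<kappa> by (simp add: numeral_2_eq_2)
  have "((\<lambda>\<alpha>. D\<^sub>t \<kappa> \<alpha> t) has_real_derivative D\<^sub>\<alpha> (D\<^sub>t \<kappa>) \<alpha> t) (at (inv ?K (?K \<alpha>)))"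
    using Ck_on_has_vector_derivative(1)[OF C1 t] Kinv by (simp add: has_real_derivative_iff_has_vector_derivative)
  from DERIV_chain2[OF this inv]
  have "((\<lambda>s. delta \<kappa> s t) has_real_derivative D\<^sub>\<alpha> (D\<^sub>t \<kappa>) \<alpha> t * inverse (D\<^sub>\<alpha> \<kappa> \<alpha> t)) (at (?K \<alpha>))"
    by (simp add: delta_def)
  then show ?thesis
    by (simp add: u_lagr_def u_arc_def D\<^sub>\<alpha>_def[of "delta \<kappa>"] divide_inverse vector_derivative_at
        has_real_derivative_iff_has_vector_derivative)
qed

text \<open>With \<open>D\<^sub>\<alpha> \<kappa> = \<bar>z\<^sub>\<alpha>\<bar>\<close> the function \<open>u_lagr\<close> is the logarithmic time derivative of \<open>\<bar>z\<^sub>\<alpha>\<bar>\<close>, so the two unknowns of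
  the system are the real and imaginary parts of the logarithmic derivative of \<open>z\<^sub>\<alpha> = \<bar>z\<^sub>\<alpha>\<bar> e\<^sup>i\<^sup>\<theta>\<close>.\<close>

lemma velocity_gradient:
  fixes z :: "real \<Rightarrow> real \<Rightarrow> complex"
  assumes T: "open T" "t \<in> T"
    and z: "Ck_on 2 T z" and \<theta>: "Ck_on 1 T \<theta>" and \<kappa>: "Ck_on 2 T \<kappa>"
    and nz: "\<And>\<alpha>. D\<^sub>\<alpha> z \<alpha> t \<noteq> 0"
    and angle: "\<And>\<tau>. \<tau> \<in> T \<Longrightarrow> D\<^sub>\<alpha> z \<alpha> \<tau> = of_real (cmod (D\<^sub>\<alpha> z \<alpha> \<tau>)) * exp (\<i> * of_real (\<theta> \<alpha> \<tau>))"
    and arclength: "arclength_coordinate T z \<kappa>"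
  shows "D\<^sub>\<alpha> (D\<^sub>t z) \<alpha> t / D\<^sub>\<alpha> z \<alpha> t = Complex (u_lagr \<kappa> \<alpha> t) (D\<^sub>t \<theta> \<alpha> t)"
proof -
  define \<rho> where "\<rho> = cmod (D\<^sub>\<alpha> z \<alpha> t)"
  define \<rho>t where "\<rho>t = D\<^sub>t (D\<^sub>\<alpha> \<kappa>) \<alpha> t"
  let ?e = "exp (\<i> * of_real (\<theta> \<alpha> t))"
  have \<kappa>_\<alpha>: "D\<^sub>\<alpha> \<kappa> x \<tau> = cmod (D\<^sub>\<alpha> z x \<tau>)" if "\<tau> \<in> T" for x \<tau>
    using arclength that by (simp add: arclength_coordinate_def)
  have u: "u_lagr \<kappa> \<alpha> t = \<rho>t / \<rho>"
    unfolding \<rho>t_def \<rho>_def \<kappa>_\<alpha>[OF T(2), symmetric] D_commute[OF \<kappa> order_refl T, symmetric]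
    using arclength T nz by (intro u_lagr_eq[OF \<kappa>]) (auto simp: arclength_coordinate_def)
  have C1: "Ck_on 1 T (D\<^sub>\<alpha> \<kappa>)"
    using \<kappa> by (simp add: numeral_2_eq_2)
  have "((\<lambda>\<tau>. D\<^sub>\<alpha> \<kappa> \<alpha> \<tau>) has_vector_derivative \<rho>t) (at t)"
    unfolding \<rho>t_def using Ck_on_has_vector_derivative(2)[OF C1 T(2)] by simp
  then have "((\<lambda>\<tau>. cmod (D\<^sub>\<alpha> z \<alpha> \<tau>)) has_vector_derivative \<rho>t) (at t)"
    by (rule has_vector_derivative_transform_within_open[OF _ T]) (simp add: \<kappa>_\<alpha>)
  then have \<rho>: "((\<lambda>\<tau>. of_real (cmod (D\<^sub>\<alpha> z \<alpha> \<tau>))) has_vector_derivative complex_of_real \<rho>t) (at t)"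
    by (intro has_vector_derivative_of_real) (simp add: has_real_derivative_iff_has_vector_derivative)
  have "((\<lambda>\<tau>. \<i> * complex_of_real (\<theta> \<alpha> \<tau>)) has_vector_derivative \<i> * of_real (D\<^sub>t \<theta> \<alpha> t)) (at t)"
    using Ck_on_has_vector_derivative(2)[OF \<theta> T(2)]
    by (intro has_vector_derivative_mult_right has_vector_derivative_of_real)
      (simp add: has_real_derivative_iff_has_vector_derivative)
  then have "((exp \<circ> (\<lambda>\<tau>. \<i> * complex_of_real (\<theta> \<alpha> \<tau>))) has_vector_derivative
       \<i> * of_real (D\<^sub>t \<theta> \<alpha> t) * ?e) (at t)"
    by (rule field_vector_diff_chain_at) (rule DERIV_exp)
  from has_vector_derivative_mult[OF \<rho> this]
  have "((\<lambda>\<tau>. of_real (cmod (D\<^sub>\<alpha> z \<alpha> \<tau>)) * exp (\<i> * of_real (\<theta> \<alpha> \<tau>))) has_vector_derivative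
      of_real \<rho> * (\<i> * of_real (D\<^sub>t \<theta> \<alpha> t) * ?e) + of_real \<rho>t * ?e) (at t)"
    by (simp add: o_def \<rho>_def)
  then have "((\<lambda>\<tau>. D\<^sub>\<alpha> z \<alpha> \<tau>) has_vector_derivative
      of_real \<rho> * (\<i> * of_real (D\<^sub>t \<theta> \<alpha> t) * ?e) + of_real \<rho>t * ?e) (at t)"
    by (rule has_vector_derivative_transform_within_open[OF _ T]) (use angle in auto)
  then have "D\<^sub>\<alpha> (D\<^sub>t z) \<alpha> t = of_real \<rho> * (\<i> * of_real (D\<^sub>t \<theta> \<alpha> t) * ?e) + of_real \<rho>t * ?e"
    unfolding D_commute[OF z order_refl T] by (simp add: D\<^sub>t_def[of "D\<^sub>\<alpha> z"] vector_derivative_at)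
  moreover have "D\<^sub>\<alpha> z \<alpha> t = of_real \<rho> * ?e"
    unfolding \<rho>_def by (rule angle[OF T(2)])
  moreover have "\<rho> \<noteq> 0"
    using nz by (simp add: \<rho>_def)
  ultimately have "D\<^sub>\<alpha> (D\<^sub>t z) \<alpha> t / D\<^sub>\<alpha> z \<alpha> t = of_real (\<rho>t / \<rho>) + \<i> * of_real (D\<^sub>t \<theta> \<alpha> t)"
    by (simp add: field_simps)
  then show ?thesis
    by (simp add: u Complex_eq)
qed

text \<open>The chain rule along a curve inside the closed fluid domain holds for whichever one-sided derivative
  \<open>frechet_derivative\<close> selects.\<close>

lemma tangential_pressure_derivative:
  fixes z :: "real \<Rightarrow> real \<Rightarrow> complex"
  assumes P: "(\<lambda>w. P w t) differentiable_on closed_fluid_domain z t"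
    and z: "((\<lambda>x. z x t) has_vector_derivative z') (at \<alpha>)"
  shows "((\<lambda>x. P (z x t) t) has_vector_derivative grad_pressure z P (z \<alpha> t) t \<bullet> z') (at \<alpha>)"
proof -
  let ?S = "closed_fluid_domain z t"
  let ?p = "frechet_derivative (\<lambda>w. P w t) (at (z \<alpha> t) within ?S)"
  have mem: "z x t \<in> ?S" for x
    by (auto simp: closed_fluid_domain_def interface_def)
  have p: "((\<lambda>w. P w t) has_derivative ?p) (at (z \<alpha> t) within ?S)"
    using P mem by (auto simp: differentiable_on_def frechet_derivative_works)
  then have lin: "linear ?p"
    by (rule has_derivative_linear)
  have "?p w = ?p (Re w *\<^sub>R 1 + Im w *\<^sub>R \<i>)" for w
    by (rule arg_cong[where f = ?p]) (simp add: complex_eq_iff)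
  also have "\<dots> w = grad_pressure z P (z \<alpha> t) t \<bullet> w" for w
    by (simp add: linear_add[OF lin] linear_scale[OF lin] grad_pressure_def grad_within_def inner_complex_def)
  finally have p_eq: "?p w = grad_pressure z P (z \<alpha> t) t \<bullet> w" for w .
  have "((\<lambda>w. P w t) \<circ> (\<lambda>x. z x t) has_derivative ?p \<circ> (\<lambda>h. h *\<^sub>R z')) (at \<alpha> within UNIV)"
    using z p mem unfolding has_vector_derivative_def
    by (intro diff_chain_within has_derivative_subset[OF p]) auto
  then show ?thesis
    by (simp add: has_vector_derivative_def o_def p_eq)
qed

section \<open>The two equations\<close>

lemma bounded_if_convergent_at_infinity:
  fixes f :: "real \<Rightarrow> complex"
  assumes "continuous_on UNIV f" "(f \<longlongrightarrow> l) at_infinity"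
  obtains M where "\<And>x. cmod (f x) \<le> M"
proof -
  have "\<forall>\<^sub>F x in at_infinity. dist (f x) l < 1"
    using assms(2) by (rule tendstoD) simp
  then obtain b where b: "\<And>x. b \<le> \<bar>x\<bar> \<Longrightarrow> dist (f x) l < 1"
    by (auto simp: eventually_at_infinity)
  obtain K where K: "\<And>x. x \<in> {-b..b} \<Longrightarrow> cmod (f x) \<le> K"
    using continuous_bounded_on_interval[OF assms(1), of "-b" b] by metis
  have "cmod (f x) \<le> max K (cmod l + 1)" for x
  proof (cases "b \<le> \<bar>x\<bar>")
    case True
    then have "cmod (f x - l) < 1" using b by (simp add: dist_norm)
    then show ?thesis using norm_triangle_ineq2[of "f x" l] by linarith
  next
    case False
    then have "x \<in> {-b..b}" by auto
    then show ?thesis using K[of x] by linarith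
  qed
  then show ?thesis by (rule that)
qed

text \<open>The bound on \<open>z\<^sub>\<alpha>\<close> comes from its limit at infinity.\<close>

lemma chord_arc_curve_at_time:
  fixes z :: "real \<Rightarrow> real \<Rightarrow> complex"
  assumes z: "Ck_on 4 T z" and t: "t \<in> T"
    and flat: "((\<lambda>\<alpha>. D\<^sub>\<alpha> z \<alpha> t) \<longlongrightarrow> 1) at_infinity"
    and c: "c > 0" "\<And>\<alpha> \<beta>. \<alpha> \<noteq> \<beta> \<Longrightarrow> cmod ((z \<alpha> t - z \<beta> t) / of_real (\<alpha> - \<beta>)) > c"
  obtains M where "chord_arc_curve (\<lambda>\<alpha>. z \<alpha> t) (\<lambda>\<alpha>. D\<^sub>\<alpha> z \<alpha> t) (\<lambda>\<alpha>. D\<^sub>\<alpha> (D\<^sub>\<alpha> z) \<alpha> t)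
      (\<lambda>\<alpha>. D\<^sub>\<alpha> (D\<^sub>\<alpha> (D\<^sub>\<alpha> z)) \<alpha> t) c M"
proof -
  have z4: "Ck_on (Suc (Suc (Suc (Suc 0)))) T z"
    using z by (simp add: eval_nat_numeral del: Ck_on.simps)
  note z3 = Ck_on_D\<^sub>\<alpha>[OF z4] note z2 = Ck_on_D\<^sub>\<alpha>[OF z3] note z1 = Ck_on_D\<^sub>\<alpha>[OF z2]
  obtain M where M: "\<And>\<alpha>. cmod (D\<^sub>\<alpha> z \<alpha> t) \<le> M"
    using bounded_if_convergent_at_infinity[OF Ck_on_imp_continuous_space[OF z3 t] flat] by blast
  show ?thesis
  proof (rule that, unfold_locales)
    fix \<alpha> \<beta>
    show "c * \<bar>\<alpha> - \<beta>\<bar> \<le> cmod (z \<alpha> t - z \<beta> t)"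
    proof (cases "\<alpha> = \<beta>")
      case False
      then show ?thesis
        using c(2)[OF False] by (simp add: norm_divide field_simps del: of_real_diff)
    qed simp
  qed (use c M t z4 z3 z2 z1 in \<open>auto intro: Ck_on_has_vector_derivative(1) Ck_on_imp_continuous_space simp del: Ck_on.simps\<close>)
qed

text \<open>Write \<open>w = z\<^sub>t\<^sub>\<alpha> / z\<^sub>\<alpha> = U + i \<theta>\<^sub>t\<close>. Differentiating \<open>cnj z\<^sub>t = H (cnj z\<^sub>t)\<close> shows that \<open>cnj z\<^sub>t\<^sub>\<alpha> / z\<^sub>\<alpha>\<close> is fixed by \<open>H\<close>; multiplying by
  \<open>z\<^sub>\<alpha> / cnj z\<^sub>\<alpha>\<close> and commuting it past \<open>H\<close> gives \<open>cnj w = H (cnj w) - C\<close> with \<open>C\<close> the commutator term, and the claim is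
  the imaginary part.\<close>

lemma angle_equation:
  fixes z :: "real \<Rightarrow> real \<Rightarrow> complex"
  assumes T: "open T" "t \<in> T"
    and smooth: "Ck_on 4 T z" "Ck_on 1 T \<theta>" "Ck_on 2 T \<kappa>"
    and flat: "((\<lambda>\<alpha>. D\<^sub>\<alpha> z \<alpha> t) \<longlongrightarrow> 1) at_infinity"
    and decay: "square_integrable (\<lambda>\<alpha>. D\<^sub>t z \<alpha> t)" "square_integrable (\<lambda>\<alpha>. D\<^sub>\<alpha> (D\<^sub>t z) \<alpha> t)"
    and chord_arc: "c > 0" "\<And>\<alpha> \<beta>. \<alpha> \<noteq> \<beta> \<Longrightarrow> cmod ((z \<alpha> t - z \<beta> t) / of_real (\<alpha> - \<beta>)) > c"
    and angle: "\<And>\<alpha> \<tau>. \<tau> \<in> T \<Longrightarrow> D\<^sub>\<alpha> z \<alpha> \<tau> = of_real (cmod (D\<^sub>\<alpha> z \<alpha> \<tau>)) * exp (\<i> * of_real (\<theta> \<alpha> \<tau>))"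
    and hilbert: "\<And>\<alpha>. cnj (D\<^sub>t z \<alpha> t) = hilbert z (\<lambda>\<alpha> t. cnj (D\<^sub>t z \<alpha> t)) \<alpha> t"
    and arclength: "arclength_coordinate T z \<kappa>"
  shows "of_real (D\<^sub>t \<theta> \<alpha> t) = \<i> * hilbert z (cplx (u_lagr \<kappa>)) \<alpha> t + err_phi z \<theta> \<kappa> \<alpha> t"
proof -
  obtain M where "chord_arc_curve (\<lambda>\<alpha>. z \<alpha> t) (\<lambda>\<alpha>. D\<^sub>\<alpha> z \<alpha> t) (\<lambda>\<alpha>. D\<^sub>\<alpha> (D\<^sub>\<alpha> z) \<alpha> t)
      (\<lambda>\<alpha>. D\<^sub>\<alpha> (D\<^sub>\<alpha> (D\<^sub>\<alpha> z)) \<alpha> t) c M"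
    using chord_arc_curve_at_time[OF smooth(1) T(2) flat chord_arc] by blast
  then interpret chord_arc_curve "\<lambda>\<alpha>. z \<alpha> t" "\<lambda>\<alpha>. D\<^sub>\<alpha> z \<alpha> t" "\<lambda>\<alpha>. D\<^sub>\<alpha> (D\<^sub>\<alpha> z) \<alpha> t"
      "\<lambda>\<alpha>. D\<^sub>\<alpha> (D\<^sub>\<alpha> (D\<^sub>\<alpha> z)) \<alpha> t" c M .
  define V where "V \<alpha> = D\<^sub>\<alpha> (D\<^sub>t z) \<alpha> t" for \<alpha>
  define w where "w \<alpha> = V \<alpha> / D\<^sub>\<alpha> z \<alpha> t" for \<alpha>
  have w: "w x = Complex (u_lagr \<kappa> x t) (D\<^sub>t \<theta> x t)" for x
    unfolding w_def V_def using Ck_on_antimono[OF smooth(1)] smooth(2,3) z'_nonzero angle arclength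
    by (intro velocity_gradient[OF T]) auto
  have z4: "Ck_on (Suc (Suc (Suc (Suc 0)))) T z"
    using smooth(1) by (simp add: eval_nat_numeral del: Ck_on.simps)
  note zt3 = Ck_on_D\<^sub>t[OF z4] note V2 = Ck_on_D\<^sub>\<alpha>[OF zt3] note V1 = Ck_on_D\<^sub>\<alpha>[OF V2]
  note z3 = Ck_on_D\<^sub>\<alpha>[OF z4]
  have zt': "((\<lambda>x. cnj (D\<^sub>t z x t)) has_vector_derivative cnj (V x)) (at x)" for x
    unfolding V_def by (intro has_vector_derivative_cnj Ck_on_has_vector_derivative(1)[OF zt3 T(2)]) simp
  have V': "(V has_vector_derivative D\<^sub>\<alpha> (D\<^sub>\<alpha> (D\<^sub>t z)) x t) (at x)" for x
    unfolding V_def[abs_def] by (intro Ck_on_has_vector_derivative(1)[OF V2 T(2)]) simp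
  have cV': "continuous_on UNIV (\<lambda>x. D\<^sub>\<alpha> (D\<^sub>\<alpha> (D\<^sub>t z)) x t)"
    using Ck_on_imp_continuous_space[OF V1 T(2)] .
  have cV: "continuous_on UNIV V"
    unfolding V_def using Ck_on_imp_continuous_space[OF V2 T(2)] by simp
  have sq_cnj: "square_integrable (\<lambda>x. cnj (f x))" if "square_integrable f" for f
    using that unfolding square_integrable_def
    by (auto intro: borel_measurable_continuous_on[of cnj] continuous_intros)
  have sq: "square_integrable (\<lambda>x. cnj (D\<^sub>t z x t))" "square_integrable (\<lambda>x. cnj (V x))"
    using decay sq_cnj by (auto simp: V_def)
  have "square_integrable w"
    using square_integrable_divide_z'[OF decay(2)] by (simp add: w_def[abs_def] V_def)
  moreover define w' where "w' x = (D\<^sub>\<alpha> (D\<^sub>\<alpha> (D\<^sub>t z)) x t * D\<^sub>\<alpha> z x t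
      - V x * D\<^sub>\<alpha> (D\<^sub>\<alpha> z) x t) / (D\<^sub>\<alpha> z x t)\<^sup>2" for x
  have "(w has_vector_derivative w' x) (at x)" for x
    unfolding w_def[abs_def] w'_def
    by (intro has_vector_derivative_quotient V' z'') (simp add: z'_nonzero)
  moreover have "continuous_on UNIV w'"
    unfolding w'_def[abs_def]
    by (intro continuous_intros cV cV' z_continuous) (simp add: z'_nonzero)
  ultimately have split: "pv_integral (\<lambda>\<beta>. cnj (w \<beta>) * D\<^sub>\<alpha> z \<beta> t / (z \<alpha> t - z \<beta> t)) \<alpha> =
    pv_integral (\<lambda>\<beta>. of_real (Re (w \<beta>)) * D\<^sub>\<alpha> z \<beta> t / (z \<alpha> t - z \<beta> t)) \<alpha>
      - \<i> * pv_integral (\<lambda>\<beta>. of_real (Im (w \<beta>)) * D\<^sub>\<alpha> z \<beta> t / (z \<alpha> t - z \<beta> t)) \<alpha>"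
    by (rule Cauchy_pv_cnj)
  define HU where "HU = hilbert z (cplx (u_lagr \<kappa>)) \<alpha> t"
  define H\<theta> where "H\<theta> = hilbert z (cplx (D\<^sub>t \<theta>)) \<alpha> t"
  have Hw: "1 / (of_real pi * \<i>) * pv_integral (\<lambda>\<beta>. cnj (w \<beta>) * D\<^sub>\<alpha> z \<beta> t / (z \<alpha> t - z \<beta> t)) \<alpha> = HU - \<i> * H\<theta>"
    unfolding split HU_def H\<theta>_def hilbert_def cplx_def by (simp add: w algebra_simps)
  \<comment> \<open>The fixed point equation as an identity of functions, so that both sides can be differentiated.\<close>
  have zt_eq: "(\<lambda>\<alpha>. cnj (D\<^sub>t z \<alpha> t)) = (\<lambda>\<alpha>. 1 / (of_real pi * \<i>) *
      pv_integral (\<lambda>\<beta>. cnj (D\<^sub>t z \<beta> t) * D\<^sub>\<alpha> z \<beta> t / (z \<alpha> t - z \<beta> t)) \<alpha>)"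
    by (rule ext) (rule hilbert[unfolded hilbert_def])
  have "((\<lambda>\<alpha>. 1 / (of_real pi * \<i>) * pv_integral (\<lambda>\<beta>. cnj (D\<^sub>t z \<beta> t) * D\<^sub>\<alpha> z \<beta> t / (z \<alpha> t - z \<beta> t)) \<alpha>)
      has_vector_derivative 1 / (of_real pi * \<i>) *
        (D\<^sub>\<alpha> z \<alpha> t * pv_integral (\<lambda>\<beta>. cnj (V \<beta>) / (z \<alpha> t - z \<beta> t)) \<alpha>)) (at \<alpha>)"
    by (intro has_vector_derivative_mult_right Cauchy_pv_has_vector_derivative[OF sq(1) zt' sq(2)
        has_vector_derivative_cnj[OF V'] continuous_on_cnj[OF cV']])
  then have "((\<lambda>\<alpha>. cnj (D\<^sub>t z \<alpha> t)) has_vector_derivative 1 / (of_real pi * \<i>) *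
        (D\<^sub>\<alpha> z \<alpha> t * pv_integral (\<lambda>\<beta>. cnj (V \<beta>) / (z \<alpha> t - z \<beta> t)) \<alpha>)) (at \<alpha>)"
    by (simp only: zt_eq[symmetric])
  from vector_derivative_unique_at[OF this zt']
  \<comment> \<open>The quotient \<open>cnj z\<^sub>t\<^sub>\<alpha> / z\<^sub>\<alpha>\<close> is again a fixed point of the Hilbert transform.\<close>
  have Vbar: "cnj (V \<alpha>) / D\<^sub>\<alpha> z \<alpha> t = 1 / (of_real pi * \<i>) * pv_integral (\<lambda>\<beta>. cnj (V \<beta>) / (z \<alpha> t - z \<beta> t)) \<alpha>"
    using z'_nonzero[of \<alpha>] by (simp add: field_simps)
  have "commutator (hilbert z) (mult_op (\<lambda>\<alpha> t. D\<^sub>\<alpha> z \<alpha> t / cnj (D\<^sub>\<alpha> z \<alpha> t)))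
         (\<lambda>\<alpha> t. cnj (D\<^sub>\<alpha> (D\<^sub>t z) \<alpha> t) / D\<^sub>\<alpha> z \<alpha> t) \<alpha> t
    = 1 / (of_real pi * \<i>) * pv_integral (\<lambda>\<beta>. cnj (w \<beta>) * D\<^sub>\<alpha> z \<beta> t / (z \<alpha> t - z \<beta> t)) \<alpha>
      - D\<^sub>\<alpha> z \<alpha> t / cnj (D\<^sub>\<alpha> z \<alpha> t) * (1 / (of_real pi * \<i>) * pv_integral (\<lambda>\<beta>. cnj (V \<beta>) / (z \<alpha> t - z \<beta> t)) \<alpha>)"
    using z'_nonzero by (simp add: commutator_def mult_op_def hilbert_def w_def V_def)
  also have "\<dots> = HU - \<i> * H\<theta> - cnj (w \<alpha>)"
    unfolding Hw Vbar[symmetric] using z'_nonzero[of \<alpha>] by (simp add: w_def)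
  finally have C: "commutator (hilbert z) (mult_op (\<lambda>\<alpha> t. D\<^sub>\<alpha> z \<alpha> t / cnj (D\<^sub>\<alpha> z \<alpha> t)))
      (\<lambda>\<alpha> t. cnj (D\<^sub>\<alpha> (D\<^sub>t z) \<alpha> t) / D\<^sub>\<alpha> z \<alpha> t) \<alpha> t = HU - \<i> * H\<theta> - cnj (w \<alpha>)" .
  show ?thesis
    unfolding err_phi_def C HU_def[symmetric] H\<theta>_def[symmetric] w
    by (rule complex_eqI) simp_all
qed

text \<open>Taking the time derivative of \<open>z\<^sub>t\<^sub>\<alpha> / z\<^sub>\<alpha> = U + i \<theta>\<^sub>t\<close> gives \<open>U\<^sub>t = Re (z\<^sub>t\<^sub>t\<^sub>\<alpha> / z\<^sub>\<alpha>) - U\<^sup>2 + \<theta>\<^sub>t\<^sup>2\<close>, and the momentum equation in the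
  moving frame reads \<open>e\<^sup>-\<^sup>i\<^sup>\<theta> (z\<^sub>t\<^sub>t + i) = D\<^sub>s\<^sup>2 \<theta> + i a\<close>, the real part being the surface tension law differentiated along the
  interface. Differentiating the real part once more produces \<open>D\<^sub>s\<^sup>3 \<theta> - a D\<^sub>s \<theta>\<close> with no derivative of \<open>a\<close>.\<close>

lemma velocity_equation:
  fixes z :: "real \<Rightarrow> real \<Rightarrow> complex"
  assumes T: "open T" "t \<in> T"
    and smooth: "Ck_on 3 T z" "Ck_on 1 T \<theta>" "Ck_on 2 T \<kappa>"
    and nz: "\<And>\<alpha> \<tau>. \<tau> \<in> T \<Longrightarrow> D\<^sub>\<alpha> z \<alpha> \<tau> \<noteq> 0"
    and angle: "\<And>\<alpha> \<tau>. \<tau> \<in> T \<Longrightarrow> D\<^sub>\<alpha> z \<alpha> \<tau> = of_real (cmod (D\<^sub>\<alpha> z \<alpha> \<tau>)) * exp (\<i> * of_real (\<theta> \<alpha> \<tau>))"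
    and P: "(\<lambda>w. P w t) differentiable_on closed_fluid_domain z t"
    and surface_tension: "\<And>\<alpha>. P (z \<alpha> t) t = - (D\<^sub>\<alpha> \<theta> \<alpha> t / cmod (D\<^sub>\<alpha> z \<alpha> t))"
    and euler: "\<And>\<alpha>. D\<^sub>t (D\<^sub>t z) \<alpha> t + \<i> = - grad_pressure z P (z \<alpha> t) t"
    and arclength: "arclength_coordinate T z \<kappa>"
  shows "D\<^sub>t (u_lagr \<kappa>) \<alpha> t =
        (D\<^sub>s_lagr z ^^ 3) \<theta> \<alpha> t - taylor_sign z \<theta> P \<alpha> t * D\<^sub>s_lagr z \<theta> \<alpha> t + err_psi z \<theta> \<kappa> \<alpha> t"
proof -
  define N where "N x = D\<^sub>t (D\<^sub>t z) x t + \<i>" for x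
  define e where "e x = exp (\<i> * complex_of_real (\<theta> x t))" for x
  define a where "a = taylor_sign z \<theta> P \<alpha> t"
  define \<rho> where "\<rho> x = cmod (D\<^sub>\<alpha> z x t)" for x
  define V where "V \<tau> = D\<^sub>\<alpha> (D\<^sub>t z) \<alpha> \<tau>" for \<tau>
  define W where "W = D\<^sub>\<alpha> (D\<^sub>t (D\<^sub>t z)) \<alpha> t"
  have \<rho>: "\<rho> x > 0" "D\<^sub>\<alpha> z x t = of_real (\<rho> x) * e x" for x
    using nz T(2) angle[OF T(2)] by (auto simp: \<rho>_def e_def)
  have cnj_e: "exp (- \<i> * complex_of_real (\<theta> x t)) = cnj (e x)" "cnj (e x) * e x = 1" for x
    by (auto simp: e_def exp_cnj exp_minus)
  have z3: "Ck_on (Suc (Suc (Suc 0))) T z"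
    using smooth(1) by (simp add: eval_nat_numeral del: Ck_on.simps)
  note zt2 = Ck_on_D\<^sub>t[OF z3] note ztt1 = Ck_on_D\<^sub>t[OF zt2] note V1 = Ck_on_D\<^sub>\<alpha>[OF zt2]
  note za2 = Ck_on_D\<^sub>\<alpha>[OF z3]
  have grad: "grad_pressure z P (z x t) t = - N x" for x
    using euler[of x] by (simp add: N_def)
  have a: "a = Im (cnj (e \<alpha>) * N \<alpha>)"
    by (simp add: a_def taylor_sign_def grad e_def inner_complex_def algebra_simps)
  \<comment> \<open>Along the interface the pressure is \<open>- D\<^sub>s \<theta>\<close> and its gradient is \<open>- N\<close>, so the tangential part of \<open>N\<close> is a second
    derivative of the angle.\<close>
  have D2: "(D\<^sub>s_lagr z ^^ 2) \<theta> x t = Re (cnj (e x) * N x)" for x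
  proof -
    have "((\<lambda>x. P (z x t) t) has_vector_derivative grad_pressure z P (z x t) t \<bullet> D\<^sub>\<alpha> z x t) (at x)"
      by (intro tangential_pressure_derivative[where P = P, OF P] Ck_on_has_vector_derivative(1)[OF z3 T(2)]) simp
    then have "((\<lambda>x. - D\<^sub>s_lagr z \<theta> x t) has_vector_derivative - (N x \<bullet> D\<^sub>\<alpha> z x t)) (at x)"
      by (simp add: surface_tension D\<^sub>s_lagr_def grad)
    from has_vector_derivative_minus[OF this]
    have "((\<lambda>x. D\<^sub>s_lagr z \<theta> x t) has_vector_derivative N x \<bullet> D\<^sub>\<alpha> z x t) (at x)"
      by simp
    then have "D\<^sub>\<alpha> (D\<^sub>s_lagr z \<theta>) x t = N x \<bullet> D\<^sub>\<alpha> z x t"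
      by (simp add: D\<^sub>\<alpha>_def[of "D\<^sub>s_lagr z \<theta>"] vector_derivative_at)
    also have "\<dots> = \<rho> x * Re (cnj (e x) * N x)"
      unfolding \<rho>(2)[of x] by (simp add: inner_complex_def algebra_simps)
    finally show ?thesis
      using \<rho>(1)[of x] by (simp add: numeral_2_eq_2 D\<^sub>s_lagr_def[of z "D\<^sub>s_lagr z \<theta>"] \<rho>_def)
  qed
  have D3: "(D\<^sub>s_lagr z ^^ 3) \<theta> \<alpha> t = Re (W / D\<^sub>\<alpha> z \<alpha> t) + a * D\<^sub>s_lagr z \<theta> \<alpha> t"
  proof -
    have \<theta>': "((\<lambda>x. \<theta> x t) has_vector_derivative D\<^sub>\<alpha> \<theta> \<alpha> t) (at \<alpha>)"
      using Ck_on_has_vector_derivative(1)[OF smooth(2) T(2)] by simp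
    then have "((\<lambda>x. - \<i> * complex_of_real (\<theta> x t)) has_vector_derivative - \<i> * of_real (D\<^sub>\<alpha> \<theta> \<alpha> t)) (at \<alpha>)"
      by (intro has_vector_derivative_mult_right has_vector_derivative_of_real)
        (simp add: has_real_derivative_iff_has_vector_derivative)
    then have "((exp \<circ> (\<lambda>x. - \<i> * complex_of_real (\<theta> x t))) has_vector_derivative
       - \<i> * of_real (D\<^sub>\<alpha> \<theta> \<alpha> t) * exp (- \<i> * of_real (\<theta> \<alpha> t))) (at \<alpha>)"
      by (rule field_vector_diff_chain_at) (rule DERIV_exp)
    then have e': "((\<lambda>x. cnj (e x)) has_vector_derivative - \<i> * of_real (D\<^sub>\<alpha> \<theta> \<alpha> t) * cnj (e \<alpha>)) (at \<alpha>)"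
      by (simp only: o_def cnj_e)
    have N': "(N has_vector_derivative W) (at \<alpha>)"
      unfolding N_def[abs_def] W_def
      using Ck_on_has_vector_derivative(1)[OF ztt1 T(2), of \<alpha>] by (auto intro!: derivative_eq_intros)
    have "((\<lambda>x. Re (cnj (e x) * N x)) has_vector_derivative
        Re (cnj (e \<alpha>) * W + - \<i> * of_real (D\<^sub>\<alpha> \<theta> \<alpha> t) * cnj (e \<alpha>) * N \<alpha>)) (at \<alpha>)"
      by (intro bounded_linear.has_vector_derivative[OF bounded_linear_Re] has_vector_derivative_mult e' N')
    moreover have "Re (cnj (e \<alpha>) * W + - \<i> * of_real (D\<^sub>\<alpha> \<theta> \<alpha> t) * cnj (e \<alpha>) * N \<alpha>)
        = Re (cnj (e \<alpha>) * W) + a * D\<^sub>\<alpha> \<theta> \<alpha> t"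
      unfolding a by (simp add: algebra_simps)
    ultimately have "D\<^sub>\<alpha> ((D\<^sub>s_lagr z ^^ 2) \<theta>) \<alpha> t = Re (cnj (e \<alpha>) * W) + a * D\<^sub>\<alpha> \<theta> \<alpha> t"
      unfolding D\<^sub>\<alpha>_def[of "(D\<^sub>s_lagr z ^^ 2) \<theta>"] D2 by (simp add: vector_derivative_at)
    moreover have "(D\<^sub>s_lagr z ^^ 3) \<theta> \<alpha> t = D\<^sub>\<alpha> ((D\<^sub>s_lagr z ^^ 2) \<theta>) \<alpha> t / \<rho> \<alpha>"
      by (simp add: eval_nat_numeral D\<^sub>s_lagr_def[of z "D\<^sub>s_lagr z (D\<^sub>s_lagr z \<theta>)"] \<rho>_def)
    moreover have "W / D\<^sub>\<alpha> z \<alpha> t = cnj (e \<alpha>) * W / of_real (\<rho> \<alpha>)"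
      using \<rho>(1)[of \<alpha>] cnj_e(2)[of \<alpha>] unfolding \<rho>(2)[of \<alpha>] by (simp add: divide_simps)
    ultimately show ?thesis
      by (simp add: add_divide_distrib D\<^sub>s_lagr_def[of z \<theta>] \<rho>_def)
  qed
  have grad_v: "V \<tau> / D\<^sub>\<alpha> z \<alpha> \<tau> = Complex (u_lagr \<kappa> \<alpha> \<tau>) (D\<^sub>t \<theta> \<alpha> \<tau>)" if "\<tau> \<in> T" for \<tau>
    unfolding V_def
    using Ck_on_antimono[OF smooth(1)] smooth(2,3) that nz angle arclength
    by (intro velocity_gradient[OF T(1)]) auto
  have "((\<lambda>\<tau>. V \<tau> / D\<^sub>\<alpha> z \<alpha> \<tau>) has_vector_derivative
      (W * D\<^sub>\<alpha> z \<alpha> t - V t * V t) / (D\<^sub>\<alpha> z \<alpha> t)\<^sup>2) (at t)"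
  proof (rule has_vector_derivative_quotient)
    have "D\<^sub>t (D\<^sub>\<alpha> (D\<^sub>t z)) \<alpha> t = W"
      unfolding W_def using D_commute[OF zt2 _ T] by simp
    then show "(V has_vector_derivative W) (at t)"
      unfolding V_def[abs_def] using Ck_on_has_vector_derivative(2)[OF V1 T(2), of \<alpha>] by simp
    have "D\<^sub>t (D\<^sub>\<alpha> z) \<alpha> t = V t"
      unfolding V_def using D_commute[OF z3 _ T] by simp
    then show "((\<lambda>\<tau>. D\<^sub>\<alpha> z \<alpha> \<tau>) has_vector_derivative V t) (at t)"
      using Ck_on_has_vector_derivative(2)[OF za2 T(2), of \<alpha>] by simp
  qed (use nz T in auto)
  then have "((\<lambda>\<tau>. Re (V \<tau> / D\<^sub>\<alpha> z \<alpha> \<tau>)) has_vector_derivative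
      Re ((W * D\<^sub>\<alpha> z \<alpha> t - V t * V t) / (D\<^sub>\<alpha> z \<alpha> t)\<^sup>2)) (at t)"
    by (rule bounded_linear.has_vector_derivative[OF bounded_linear_Re])
  then have "((\<lambda>\<tau>. u_lagr \<kappa> \<alpha> \<tau>) has_vector_derivative
      Re ((W * D\<^sub>\<alpha> z \<alpha> t - V t * V t) / (D\<^sub>\<alpha> z \<alpha> t)\<^sup>2)) (at t)"
    by (rule has_vector_derivative_transform_within_open[OF _ T]) (simp add: grad_v)
  moreover have "(W * D\<^sub>\<alpha> z \<alpha> t - V t * V t) / (D\<^sub>\<alpha> z \<alpha> t)\<^sup>2 = W / D\<^sub>\<alpha> z \<alpha> t - (V t / D\<^sub>\<alpha> z \<alpha> t)\<^sup>2"
    using nz[OF T(2), of \<alpha>] by (simp add: field_simps power2_eq_square)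
  ultimately have "D\<^sub>t (u_lagr \<kappa>) \<alpha> t = Re (W / D\<^sub>\<alpha> z \<alpha> t) - Re ((V t / D\<^sub>\<alpha> z \<alpha> t)\<^sup>2)"
    by (simp add: D\<^sub>t_def vector_derivative_at)
  also have "Re ((V t / D\<^sub>\<alpha> z \<alpha> t)\<^sup>2) = (u_lagr \<kappa> \<alpha> t)\<^sup>2 - (D\<^sub>t \<theta> \<alpha> t)\<^sup>2"
    unfolding grad_v[OF T(2)] by (simp add: power2_eq_square)
  also have "err_psi z \<theta> \<kappa> \<alpha> t = - (u_lagr \<kappa> \<alpha> t)\<^sup>2 + (D\<^sub>t \<theta> \<alpha> t)\<^sup>2"
  proof -
    have "cnj (e \<alpha>) * V t / of_real (\<rho> \<alpha>) = V t / D\<^sub>\<alpha> z \<alpha> t"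
      using \<rho>(1)[of \<alpha>] cnj_e(2)[of \<alpha>] unfolding \<rho>(2)[of \<alpha>] by (simp add: divide_simps)
    then show ?thesis
      unfolding err_psi_def cnj_e(1) V_def[symmetric] \<rho>_def[symmetric]
      by (simp add: grad_v[OF T(2)] power2_eq_square)
  qed
  ultimately show ?thesis
    unfolding D3 a_def by simp
qed

theorem proposition1p1:
  fixes T :: "real set" and c :: real
    and z :: "real \<Rightarrow> real \<Rightarrow> complex"
    and \<theta> \<kappa> :: "real \<Rightarrow> real \<Rightarrow> real"
    and v :: "complex \<Rightarrow> real \<Rightarrow> complex"
    and P :: "complex \<Rightarrow> real \<Rightarrow> real"
  assumes time: "open T" "is_interval T"
    and smooth: "Ck_on 4 T z" "Ck_on 3 T \<theta>" "Ck_on 2 T \<kappa>"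
    and flat: "\<And>t. t \<in> T \<Longrightarrow> ((\<lambda>\<alpha>. D\<^sub>\<alpha> z \<alpha> t) \<longlongrightarrow> 1) at_infinity"
      "\<And>t. t \<in> T \<Longrightarrow> bounded (range (\<lambda>\<alpha>. Im (z \<alpha> t)))"
    and decay: "\<And>t. t \<in> T \<Longrightarrow> square_integrable (\<lambda>\<alpha>. D\<^sub>t z \<alpha> t)"
      "\<And>t. t \<in> T \<Longrightarrow> square_integrable (\<lambda>\<alpha>. D\<^sub>\<alpha> (D\<^sub>t z) \<alpha> t)"
    and chord_arc: "c > 0"
      "\<And>\<alpha> \<beta> t. t \<in> T \<Longrightarrow> \<alpha> \<noteq> \<beta> \<Longrightarrow> cmod ((z \<alpha> t - z \<beta> t) / of_real (\<alpha> - \<beta>)) > c"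
    and angle: "\<And>\<alpha> t. t \<in> T \<Longrightarrow> D\<^sub>\<alpha> z \<alpha> t = of_real (cmod (D\<^sub>\<alpha> z \<alpha> t)) * exp (\<i> * of_real (\<theta> \<alpha> t))"
    and euler: "incompressible_euler_flow T z v P"
    and lagrangian: "\<And>\<alpha> t. t \<in> T \<Longrightarrow> D\<^sub>t z \<alpha> t = v (z \<alpha> t) t"
    and surface_tension: "\<And>\<alpha> t. t \<in> T \<Longrightarrow> P (z \<alpha> t) t = - (D\<^sub>\<alpha> \<theta> \<alpha> t / cmod (D\<^sub>\<alpha> z \<alpha> t))"
    and interface_eq: "\<And>\<alpha> t. t \<in> T \<Longrightarrow> D\<^sub>t (D\<^sub>t z) \<alpha> t + \<i> = - grad_pressure z P (z \<alpha> t) t"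
      "\<And>\<alpha> t. t \<in> T \<Longrightarrow> cnj (D\<^sub>t z \<alpha> t) = hilbert z (\<lambda>\<alpha> t. cnj (D\<^sub>t z \<alpha> t)) \<alpha> t"
    and taylor: "\<And>\<alpha> t. t \<in> T \<Longrightarrow> taylor_sign z \<theta> P \<alpha> t > 0"
    and arclength: "arclength_coordinate T z \<kappa>"
  shows "\<forall>t\<in>T. \<forall>\<alpha>.
      of_real (D\<^sub>t \<theta> \<alpha> t) = \<i> * hilbert z (cplx (u_lagr \<kappa>)) \<alpha> t + err_phi z \<theta> \<kappa> \<alpha> t \<and>
      D\<^sub>t (u_lagr \<kappa>) \<alpha> t =
        (D\<^sub>s_lagr z ^^ 3) \<theta> \<alpha> t - taylor_sign z \<theta> P \<alpha> t * D\<^sub>s_lagr z \<theta> \<alpha> t + err_psi z \<theta> \<kappa> \<alpha> t"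
proof (intro ballI allI conjI)
  fix t \<alpha> assume t: "t \<in> T"
  have nz: "D\<^sub>\<alpha> z x \<tau> \<noteq> 0" if "\<tau> \<in> T" for x \<tau>
    by (rule chord_arc_curve_at_time[OF smooth(1) that flat(1)[OF that] chord_arc(1) chord_arc(2)[OF that]])
      (auto dest: chord_arc_curve.z'_nonzero)
  have P: "(\<lambda>w. P w t) differentiable_on closed_fluid_domain z t"
    using euler t by (auto simp: incompressible_euler_flow_def)
  show "of_real (D\<^sub>t \<theta> \<alpha> t) = \<i> * hilbert z (cplx (u_lagr \<kappa>)) \<alpha> t + err_phi z \<theta> \<kappa> \<alpha> t"
    by (rule angle_equation[OF time(1) t smooth(1) Ck_on_antimono[OF smooth(2)] smooth(3) flat(1)[OF t] decay(1,2)[OF t]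
          chord_arc(1) chord_arc(2)[OF t] angle interface_eq(2)[OF t] arclength]) simp_all
  show "D\<^sub>t (u_lagr \<kappa>) \<alpha> t =
        (D\<^sub>s_lagr z ^^ 3) \<theta> \<alpha> t - taylor_sign z \<theta> P \<alpha> t * D\<^sub>s_lagr z \<theta> \<alpha> t + err_psi z \<theta> \<kappa> \<alpha> t"
    by (rule velocity_equation[OF time(1) t Ck_on_antimono[OF smooth(1)] Ck_on_antimono[OF smooth(2)] smooth(3) nz angle P
          surface_tension[OF t] interface_eq(1)[OF t] arclength]) simp_all
qed


end
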